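(* Let $G$ be a group such that the graded Lie algebra $\mathrm{gr}_\Gamma(G)$ has trivial center. For each $q\ge1$, the following statements are equivalent: (1) $J\circ\iota_F\colon\mathrm{gr}^s_\Gamma(\mathcal{T}_G)\to\mathrm{Der}^s(\mathrm{gr}_\Gamma(G))$ is injective, for all $s\le q$. (2) $\widetilde J\circ\iota_{\widetilde F}\colon\mathrm{gr}^s_\Gamma(\widetilde{\mathcal{T}}_G)\to\widetilde{\mathrm{Der}}^s(\mathrm{gr}_\Gamma(G))$ is injective, for all $s\le q$. (3) $\Gamma^s(\mathcal{T}_G)=F^s(\mathcal{T}_G)$, for all $s\le q+1$. (4) $\Gamma^s(\widetilde{\mathcal{T}}_G)=\widetilde F^s(\widetilde{\mathcal{T}}_G)$, for all $s\le q+1$.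
   Context: All indices $s$ are $\ge 1$. For a group $G$, $(x,y)=xyx^{-1}y^{-1}$, $\Gamma^1(G)=G$, $\Gamma^{s+1}(G)=(\Gamma^s(G),G)$, and $\mathrm{gr}_\Gamma(G)=\bigoplus_{s\ge1}\Gamma^s(G)/\Gamma^{s+1}(G)$ is the associated graded Lie algebra (over $\mathbb{Z}$), with bracket induced by the commutator. The Johnson filtration on $\mathrm{Aut}(G)$ (product = composition) is $F^s=\{\alpha\mid\alpha(x)x^{-1}\in\Gamma^{s+1}(G)\ \forall x\in G\}$, $s\ge0$; $(F^s,F^t)\subseteq F^{s+t}$. The Torelli group is $\mathcal{T}_G=F^1$, with $F^s(\mathcal{T}_G)=F^s$ for $s\ge1$, and $\mathrm{gr}_F(\mathcal{T}_G)=\bigoplus_{s\ge1}F^s/F^{s+1}$. Let $\pi\colon\mathrm{Aut}(G)\to\mathrm{Out}(G)=\mathrm{Aut}(G)/\mathrm{Inn}(G)$, $\widetilde F^s=\pi(F^s)$, $\widetilde{\mathcal{T}}_G=\widetilde F^1$, $\widetilde F^s(\widetilde{\mathcal{T}}_G)=\widetilde F^s$, $\mathrm{gr}_{\widetilde F}(\widetilde{\mathcal{T}}_G)=\bigoplus_{s\ge1}\widetilde F^s/\widetilde F^{s+1}$, and let $\bar\pi\colon\mathrm{gr}_F(\mathcal{T}_G)\to\mathrm{gr}_{\widetilde F}(\widetilde{\mathcal{T}}_G)$ be induced by $\pi$. The inclusions $\Gamma^s(\mathcal{T}_G)\subseteq F^s$ and $\Gamma^s(\widetilde{\mathcal{T}}_G)\subseteq\widetilde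 F^s$ induce morphisms of graded Lie algebras $\iota_F\colon\mathrm{gr}_\Gamma(\mathcal{T}_G)\to\mathrm{gr}_F(\mathcal{T}_G)$ and $\iota_{\widetilde F}\colon\mathrm{gr}_\Gamma(\widetilde{\mathcal{T}}_G)\to\mathrm{gr}_{\widetilde F}(\widetilde{\mathcal{T}}_G)$. For a graded Lie algebra $\mathfrak{g}$, $\mathrm{Der}(\mathfrak{g})=\bigoplus_{s\ge1}\mathrm{Der}^s(\mathfrak{g})$, with $\mathrm{Der}^s(\mathfrak{g})$ the linear derivations raising degree by $s$; $\widetilde{\mathrm{Der}}(\mathfrak{g})=\mathrm{Der}(\mathfrak{g})/\mathrm{im}(\mathrm{ad})$, graded accordingly, with projection $q_{\mathrm{Der}}\colon\mathrm{Der}(\mathfrak g)\to\widetilde{\mathrm{Der}}(\mathfrak g)$. The Johnson homomorphism $J\colon\mathrm{gr}_F(\mathcal{T}_G)\to\mathrm{Der}(\mathrm{gr}_\Gamma(G))$ is the (well-defined, injective) morphism of graded Lie algebras $J(\bar\alpha)(\bar x)=\overline{\alpha(x)x^{-1}}\in\mathrm{gr}_\Gamma^{s+t}(G)$ for $\alpha\in F^s$, $x\in\Gamma^t(G)$. When $\mathrm{gr}_\Gamma(G)$ is centerless, the outer Johnson homomorphism $\widetilde J\colon\mathrm{gr}_{\widetilde F}(\widetilde{\mathcal{T}}_G)\to\widetilde{\mathrm{Der}}(\mathrm{gr}_\Gamma(G))$ is the unique (injective) morphism of graded Lie algebras with $\widetilde J\circ\bar\pi=q_{\mathrm{Der}}\circ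 J$. *)

theory Defs
  imports "HOL-Algebra.Product_Groups" "HOL-Algebra.Bij" "HOL-Algebra.FiniteProduct"
begin

section \<open>Lower central series, automorphisms and outer automorphisms\<close>

definition group_commutator :: "('a, 'b) monoid_scheme \<Rightarrow> 'a \<Rightarrow> 'a \<Rightarrow> 'a" where
  "group_commutator G x y = x \<otimes>\<^bsub>G\<^esub> y \<otimes>\<^bsub>G\<^esub> inv\<^bsub>G\<^esub> x \<otimes>\<^bsub>G\<^esub> inv\<^bsub>G\<^esub> y"

definition commutator_subgroup :: "('a, 'b) monoid_scheme \<Rightarrow> 'a set \<Rightarrow> 'a set \<Rightarrow> 'a set" where
  "commutator_subgroup G H K = generate G {group_commutator G h k | h k. h \<in> H \<and> k \<in> K}"

text \<open>The series is indexed from 1, with \<open>\<Gamma>\<^sup>1 = G\<close>; the value at 0 is a dummy.\<close>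

fun lower_central :: "('a, 'b) monoid_scheme \<Rightarrow> nat \<Rightarrow> 'a set" where
  "lower_central G 0 = carrier G"
| "lower_central G (Suc 0) = carrier G"
| "lower_central G (Suc (Suc s)) = commutator_subgroup G (lower_central G (Suc s)) (carrier G)"

definition johnson_filtration :: "('a, 'b) monoid_scheme \<Rightarrow> nat \<Rightarrow> ('a \<Rightarrow> 'a) set" where
  "johnson_filtration G s =
     {\<alpha> \<in> carrier (AutoGroup G). \<forall>x \<in> carrier G. \<alpha> x \<otimes>\<^bsub>G\<^esub> inv\<^bsub>G\<^esub> x \<in> lower_central G (s + 1)}"

definition inner_automorphisms :: "('a, 'b) monoid_scheme \<Rightarrow> ('a \<Rightarrow> 'a) set" where
  "inner_automorphisms G =
     (\<lambda>g. \<lambda>x \<in> carrier G. g \<otimes>\<^bsub>G\<^esub> x \<otimes>\<^bsub>G\<^esub> inv\<^bsub>G\<^esub> g) ` carrier G"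

definition OutGroup :: "('a, 'b) monoid_scheme \<Rightarrow> ('a \<Rightarrow> 'a) set monoid" where
  "OutGroup G = AutoGroup G Mod inner_automorphisms G"

definition out_proj :: "('a, 'b) monoid_scheme \<Rightarrow> ('a \<Rightarrow> 'a) \<Rightarrow> ('a \<Rightarrow> 'a) set" where
  "out_proj G \<alpha> = inner_automorphisms G #>\<^bsub>AutoGroup G\<^esub> \<alpha>"

definition outer_johnson_filtration ::
    "('a, 'b) monoid_scheme \<Rightarrow> nat \<Rightarrow> ('a \<Rightarrow> 'a) set set" where
  "outer_johnson_filtration G s = out_proj G ` johnson_filtration G s"

definition torelli :: "('a, 'b) monoid_scheme \<Rightarrow> ('a \<Rightarrow> 'a) monoid" where
  "torelli G = AutoGroup G \<lparr>carrier := johnson_filtration G 1\<rparr>"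

definition outer_torelli :: "('a, 'b) monoid_scheme \<Rightarrow> ('a \<Rightarrow> 'a) set monoid" where
  "outer_torelli G = OutGroup G \<lparr>carrier := outer_johnson_filtration G 1\<rparr>"


section \<open>Graded Lie algebras over the integers\<close>

text \<open>
  The underlying additive group is an HOL-Algebra group, hence written multiplicatively;
  linear maps over the integers are group homomorphisms. \<open>homog L s\<close> is the homogeneous part
  of degree \<open>s\<close>, where only the degrees \<open>s \<ge> 1\<close> matter.
\<close>

record 'a graded_lie = "'a monoid" +
  bracket :: "'a \<Rightarrow> 'a \<Rightarrow> 'a"
  homog :: "nat \<Rightarrow> 'a set"

definition lie_center :: "('a, 'b) graded_lie_scheme \<Rightarrow> 'a set" where
  "lie_center L = {x \<in> carrier L. \<forall>y \<in> carrier L. bracket L x y = \<one>\<^bsub>L\<^esub>}"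

definition lie_quotient :: "('a, 'b) graded_lie_scheme \<Rightarrow> 'a set \<Rightarrow> 'a set graded_lie" where
  "lie_quotient L I =
    \<lparr>carrier = carrier (L Mod I), mult = mult (L Mod I), one = one (L Mod I),
     bracket = (\<lambda>X Y. the_elem ((\<lambda>(x, y). I #>\<^bsub>L\<^esub> bracket L x y) ` (X \<times> Y))),
     homog = (\<lambda>s. (\<lambda>x. I #>\<^bsub>L\<^esub> x) ` homog L s)\<rparr>"

subsection \<open>The graded Lie algebra of a filtration\<close>

text \<open>
  Here \<open>K\<close> is a filtration \<open>K 1 \<supseteq> K 2 \<supseteq> \<dots>\<close> of \<open>H\<close> by subgroups with
  \<open>K 1 = H\<close> and \<open>(K s, K t) \<subseteq> K (s + t)\<close>. Maps induced on cosets are given by \<open>the_elem\<close> of the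
  set of all values on representatives.
\<close>

definition gr_part :: "('a, 'b) monoid_scheme \<Rightarrow> (nat \<Rightarrow> 'a set) \<Rightarrow> nat \<Rightarrow> 'a set monoid" where
  "gr_part H K s = (H\<lparr>carrier := K s\<rparr>) Mod (K (s + 1))"

definition gr_part_bracket ::
    "('a, 'b) monoid_scheme \<Rightarrow> (nat \<Rightarrow> 'a set) \<Rightarrow> nat \<Rightarrow> nat \<Rightarrow> 'a set \<Rightarrow> 'a set \<Rightarrow> 'a set" where
  "gr_part_bracket H K s t X Y =
     the_elem ((\<lambda>(x, y). K (s + t + 1) #>\<^bsub>H\<^esub> group_commutator H x y) ` (X \<times> Y))"

text \<open>
  An element of the direct sum is the family of its components; the bracket is the bilinear
  extension of the brackets of homogeneous elements.
\<close>

definition gr :: "('a, 'b) monoid_scheme \<Rightarrow> (nat \<Rightarrow> 'a set) \<Rightarrow> (nat \<Rightarrow> 'a set) graded_lie" where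
  "gr H K =
    \<lparr>carrier = carrier (sum_group {1..} (gr_part H K)),
     mult = mult (sum_group {1..} (gr_part H K)),
     one = one (sum_group {1..} (gr_part H K)),
     bracket = (\<lambda>X Y. \<lambda>n \<in> {1..}.
        finprod (gr_part H K n) (\<lambda>s. gr_part_bracket H K s (n - s) (X s) (Y (n - s))) {1..<n}),
     homog = (\<lambda>s. {X \<in> carrier (sum_group {1..} (gr_part H K)).
        \<forall>t \<in> {1..}. t \<noteq> s \<longrightarrow> X t = \<one>\<^bsub>gr_part H K t\<^esub>})\<rparr>"

text \<open>
  The map \<open>gr H K \<rightarrow> gr H' K'\<close> induced by a homomorphism \<open>h\<close> from \<open>H\<close> to \<open>H'\<close> that maps each
  \<open>K s\<close> into \<open>K' s\<close>.
\<close>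

definition gr_map ::
    "('a, 'b) monoid_scheme \<Rightarrow> (nat \<Rightarrow> 'a set) \<Rightarrow> ('c, 'd) monoid_scheme \<Rightarrow> (nat \<Rightarrow> 'c set) \<Rightarrow>
     ('a \<Rightarrow> 'c) \<Rightarrow> (nat \<Rightarrow> 'a set) \<Rightarrow> (nat \<Rightarrow> 'c set)" where
  "gr_map H K H' K' h =
     (\<lambda>X \<in> carrier (gr H K). \<lambda>s \<in> {1..}. the_elem ((\<lambda>x. K' (s + 1) #>\<^bsub>H'\<^esub> h x) ` X s))"

subsection \<open>Derivations and outer derivations\<close>

definition derivation_group :: "('a, 'b) graded_lie_scheme \<Rightarrow> ('a \<Rightarrow> 'a) monoid" where
  "derivation_group L =
    \<lparr>carrier = {d \<in> hom L L \<inter> extensional (carrier L). \<forall>x \<in> carrier L. \<forall>y \<in> carrier L.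
        d (bracket L x y) = bracket L (d x) y \<otimes>\<^bsub>L\<^esub> bracket L x (d y)},
     mult = (\<lambda>d e. \<lambda>x \<in> carrier L. d x \<otimes>\<^bsub>L\<^esub> e x),
     one = (\<lambda>x \<in> carrier L. \<one>\<^bsub>L\<^esub>)\<rparr>"

definition homog_derivations :: "('a, 'b) graded_lie_scheme \<Rightarrow> nat \<Rightarrow> ('a \<Rightarrow> 'a) set" where
  "homog_derivations L s =
     {d \<in> carrier (derivation_group L). \<forall>t \<ge> 1. d ` homog L t \<subseteq> homog L (t + s)}"

text \<open>
  \<open>Der L\<close> is the (automatically direct) sum of the groups of derivations of degree \<open>s \<ge> 1\<close>
  inside the group of all derivations.
\<close>

definition Der :: "('a, 'b) graded_lie_scheme \<Rightarrow> ('a \<Rightarrow> 'a) graded_lie" where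
  "Der L =
    \<lparr>carrier = generate (derivation_group L) (\<Union>s \<in> {1..}. homog_derivations L s),
     mult = mult (derivation_group L),
     one = one (derivation_group L),
     bracket = (\<lambda>d e. \<lambda>x \<in> carrier L. d (e x) \<otimes>\<^bsub>L\<^esub> inv\<^bsub>L\<^esub> (e (d x))),
     homog = homog_derivations L\<rparr>"

definition inner_derivations :: "('a, 'b) graded_lie_scheme \<Rightarrow> ('a \<Rightarrow> 'a) set" where
  "inner_derivations L = (\<lambda>x. \<lambda>y \<in> carrier L. bracket L x y) ` carrier L"

definition outer_Der :: "('a, 'b) graded_lie_scheme \<Rightarrow> ('a \<Rightarrow> 'a) set graded_lie" where
  "outer_Der L = lie_quotient (Der L) (inner_derivations L)"

definition Der_proj :: "('a, 'b) graded_lie_scheme \<Rightarrow> ('a \<Rightarrow> 'a) \<Rightarrow> ('a \<Rightarrow> 'a) set" where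
  "Der_proj L d = inner_derivations L #>\<^bsub>Der L\<^esub> d"


section \<open>The Johnson homomorphisms\<close>

abbreviation gr_lcs :: "('a, 'b) monoid_scheme \<Rightarrow> (nat \<Rightarrow> 'a set) graded_lie" where
  "gr_lcs G \<equiv> gr G (lower_central G)"

abbreviation gr_johnson :: "('a, 'b) monoid_scheme \<Rightarrow> (nat \<Rightarrow> ('a \<Rightarrow> 'a) set) graded_lie" where
  "gr_johnson G \<equiv> gr (torelli G) (johnson_filtration G)"

abbreviation gr_outer_johnson ::
    "('a, 'b) monoid_scheme \<Rightarrow> (nat \<Rightarrow> ('a \<Rightarrow> 'a) set set) graded_lie" where
  "gr_outer_johnson G \<equiv> gr (outer_torelli G) (outer_johnson_filtration G)"

definition gr_out_proj ::
    "('a, 'b) monoid_scheme \<Rightarrow> (nat \<Rightarrow> ('a \<Rightarrow> 'a) set) \<Rightarrow> (nat \<Rightarrow> ('a \<Rightarrow> 'a) set set)" where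
  "gr_out_proj G =
     gr_map (torelli G) (johnson_filtration G) (outer_torelli G) (outer_johnson_filtration G)
       (out_proj G)"

definition iota ::
    "('a, 'b) monoid_scheme \<Rightarrow> (nat \<Rightarrow> ('a \<Rightarrow> 'a) set) \<Rightarrow> (nat \<Rightarrow> ('a \<Rightarrow> 'a) set)" where
  "iota G =
     gr_map (torelli G) (lower_central (torelli G)) (torelli G) (johnson_filtration G) id"

definition outer_iota ::
    "('a, 'b) monoid_scheme \<Rightarrow> (nat \<Rightarrow> ('a \<Rightarrow> 'a) set set) \<Rightarrow> (nat \<Rightarrow> ('a \<Rightarrow> 'a) set set)" where
  "outer_iota G =
     gr_map (outer_torelli G) (lower_central (outer_torelli G))
       (outer_torelli G) (outer_johnson_filtration G) id"

text \<open>
  On homogeneous elements, with \<open>A \<in> F\<^sup>s / F\<^bsup>s+1\<^esup>\<close> and \<open>X \<in> \<Gamma>\<^sup>t / \<Gamma>\<^bsup>t+1\<^esup>\<close>: the class of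
  \<open>\<alpha>(x) x\<inverse>\<close> for \<open>\<alpha> \<in> A\<close>, \<open>x \<in> X\<close>.
\<close>

definition johnson_part ::
    "('a, 'b) monoid_scheme \<Rightarrow> nat \<Rightarrow> nat \<Rightarrow> ('a \<Rightarrow> 'a) set \<Rightarrow> 'a set \<Rightarrow> 'a set" where
  "johnson_part G s t A X =
     the_elem ((\<lambda>(\<alpha>, x). lower_central G (s + t + 1) #>\<^bsub>G\<^esub> (\<alpha> x \<otimes>\<^bsub>G\<^esub> inv\<^bsub>G\<^esub> x)) ` (A \<times> X))"

definition johnson_hom ::
    "('a, 'b) monoid_scheme \<Rightarrow> (nat \<Rightarrow> ('a \<Rightarrow> 'a) set) \<Rightarrow> (nat \<Rightarrow> 'a set) \<Rightarrow> (nat \<Rightarrow> 'a set)" where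
  "johnson_hom G =
     (\<lambda>A \<in> carrier (gr_johnson G). \<lambda>X \<in> carrier (gr_lcs G). \<lambda>n \<in> {1..}.
        finprod (gr_part G (lower_central G) n)
          (\<lambda>s. johnson_part G s (n - s) (A s) (X (n - s))) {1..<n})"

text \<open>
  Since \<open>gr_out_proj G\<close> is onto \<open>gr_outer_johnson G\<close>, the equation below already determines the
  outer Johnson homomorphism as a map. It has a solution when \<open>gr_lcs G\<close> is centerless.
\<close>

definition outer_johnson_hom ::
    "('a, 'b) monoid_scheme \<Rightarrow>
     (nat \<Rightarrow> ('a \<Rightarrow> 'a) set set) \<Rightarrow> ((nat \<Rightarrow> 'a set) \<Rightarrow> (nat \<Rightarrow> 'a set)) set" where
  "outer_johnson_hom G =
     (THE f. f \<in> extensional (carrier (gr_outer_johnson G)) \<and>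
        (\<forall>A \<in> carrier (gr_johnson G).
           f (gr_out_proj G A) = Der_proj (gr_lcs G) (johnson_hom G A)))"

end

theory Submission
  imports Defs
begin

text \<open>
  The map \<open>J \<circ> \<iota>\<^sub>F\<close> is injective in degree \<open>s\<close> iff
  \<open>\<Gamma>\<^sup>s(T) \<inter> F\<^bsup>s+1\<^esup> \<subseteq> \<Gamma>\<^bsup>s+1\<^esup>(T)\<close>, since \<open>J\<close> is injective; starting from \<open>\<Gamma>\<^sup>1(T) = F\<^sup>1\<close>, these
  inclusions for \<open>s \<le> q\<close> amount to \<open>\<Gamma>\<^sup>s(T) = F\<^sup>s\<close> for \<open>s \<le> q + 1\<close>. The same argument applies to
  the outer version once the outer Johnson homomorphism is known to exist and to be injective.

  Both facts, and the passage between \<open>T\<close> and its outer quotient, rest on one consequence of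
  centerlessness: conjugation by \<open>g\<close> lies in \<open>F\<^sup>s\<close> only if \<open>g \<in> \<Gamma>\<^sup>s(G)\<close>. The bracket of the graded
  Lie algebra of \<open>G\<close> is \<open>J\<close> applied to the classes of inner automorphisms, so the coset of \<open>J(A)\<close>
  modulo inner derivations is the image under \<open>J\<close> of the coset of \<open>A\<close> modulo classes of inner
  automorphisms, and the latter cosets are exactly the fibres of the projection to the outer
  graded Lie algebra.
\<close>

text \<open>The outer side hides a loss of degree: if two automorphisms have the same outer class,
  they differ by conjugation by an element g of which nothing is known but g \<in> G. Centerlessness
  repairs this one degree at a time: if g lies in \<Gamma>^s(G) and conjugation by g in F^(s+1),
  then the class of g in degree s has trivial bracket with every class, hence is trivial, and g lies
  in \<Gamma>^(s+1)(G). The lower central series enters as the smallest filtration that starts with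
  the whole group and satisfies (K^s, K^t) \<subseteq> K^(s+t); this makes it compatible with the
  projection of T to its outer quotient. J is injective because F^s tests an automorphism on all of
  G = \<Gamma>^1(G), so that the values of J(A) on classes of degree one already determine A. Cosets
  and direct sums are concrete sets and families. Each induced map is therefore handled through
  representatives, and a choice made in all degrees at once has to keep the support finite.\<close>

declare lower_central.simps(3) [simp del]

section \<open>Commutators and cosets in a group\<close>

context group begin

text \<open>With \<open>m_assoc\<close> as a rewrite rule all products lean to the right, so a
  factor meets its inverse only inside a longer product; these rules cancel it there.\<close>

lemma inv_mult_cancel [simp]:
  "\<lbrakk>x \<in> carrier G; y \<in> carrier G\<rbrakk> \<Longrightarrow> inv x \<otimes> (x \<otimes> y) = y"
  "\<lbrakk>x \<in> carrier G; y \<in> carrier G\<rbrakk> \<Longrightarrow> x \<otimes> (inv x \<otimes> y) = y"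
  by (simp_all flip: m_assoc)

lemma group_commutator_closed [simp]:
  "x \<in> carrier G \<Longrightarrow> y \<in> carrier G \<Longrightarrow> group_commutator G x y \<in> carrier G"
  by (simp add: group_commutator_def)

text \<open>The commutator is the only solution \<open>c\<close> of the last equation; solving it
  avoids the inverses in the definition.\<close>

lemma group_commutator_eqI:
  assumes "x \<in> carrier G" "y \<in> carrier G" "c \<in> carrier G" "x \<otimes> y = c \<otimes> (y \<otimes> x)"
  shows "group_commutator G x y = c"
proof -
  have "group_commutator G x y = (x \<otimes> y) \<otimes> inv (y \<otimes> x)"
    using assms(1,2) by (simp add: group_commutator_def inv_mult_group m_assoc)
  also have "\<dots> = c"
    using assms by (simp add: m_assoc)
  finally show ?thesis .
qed

lemma group_commutator_mult_swap:
  assumes "x \<in> carrier G" "y \<in> carrier G"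
  shows "group_commutator G x y \<otimes> (y \<otimes> x) = x \<otimes> y"
  using assms by (simp add: group_commutator_def m_assoc)

text \<open>Both extra factors slide out: \<open>a\<close> is central, and \<open>b\<close>, placed
  to the right of \<open>z\<close>, only ever has to pass \<open>y\<close>.\<close>

lemma group_commutator_absorb:
  assumes c: "a \<in> carrier G" "b \<in> carrier G" "y \<in> carrier G" "z \<in> carrier G"
    and "\<And>u. u \<in> carrier G \<Longrightarrow> a \<otimes> u = u \<otimes> a" and comm: "b \<otimes> y = y \<otimes> b"
  shows "group_commutator G (a \<otimes> y) (z \<otimes> b) = group_commutator G y z"
proof (rule group_commutator_eqI)
  let ?k = "group_commutator G y z"
  have k: "?k \<in> carrier G" using c by simp
  have "?k \<otimes> ((z \<otimes> b) \<otimes> (a \<otimes> y)) = ?k \<otimes> (((z \<otimes> b) \<otimes> a) \<otimes> y)"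
    using c by (simp add: m_assoc)
  also have "\<dots> = ?k \<otimes> ((a \<otimes> (z \<otimes> b)) \<otimes> y)"
    using c assms(5)[of "z \<otimes> b"] by simp
  also have "\<dots> = (?k \<otimes> a) \<otimes> (z \<otimes> (b \<otimes> y))"
    using c by (simp add: m_assoc)
  also have "\<dots> = (a \<otimes> ?k) \<otimes> (z \<otimes> (y \<otimes> b))"
    using assms(5)[OF k] by (simp add: comm)
  also have "\<dots> = a \<otimes> ((?k \<otimes> (z \<otimes> y)) \<otimes> b)"
    using c by (simp add: m_assoc)
  also have "\<dots> = a \<otimes> ((y \<otimes> z) \<otimes> b)"
    using c by (simp only: group_commutator_mult_swap)
  finally show "a \<otimes> y \<otimes> (z \<otimes> b) = ?k \<otimes> (z \<otimes> b \<otimes> (a \<otimes> y))"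
    using c by (simp add: m_assoc)
qed (use c in auto)

lemma rcos_eq_iff:
  assumes "subgroup N G" "x \<in> carrier G" "y \<in> carrier G"
  shows "N #> x = N #> y \<longleftrightarrow> x \<otimes> inv y \<in> N"
proof -
  have "N #> x = N #> y \<longleftrightarrow> x \<in> N #> y"
    using assms repr_independence[of x N y] rcos_self[of x N] by auto
  then show ?thesis
    using subgroup.rcos_module[OF assms(1) is_group assms(3,2)] by simp
qed

end

lemma (in normal) rcos_group_commutator_eq:
  assumes "x \<in> carrier G" "y \<in> carrier G"
  shows "(H #> x) <#> (H #> y) = (H #> y) <#> (H #> x) \<longleftrightarrow> group_commutator G x y \<in> H"
proof -
  have "(H #> x) <#> (H #> y) = (H #> y) <#> (H #> x) \<longleftrightarrow> H #> (x \<otimes> y) = H #> (y \<otimes> x)"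
    using assms by (simp add: rcos_sum)
  also have "\<dots> \<longleftrightarrow> (x \<otimes> y) \<otimes> inv (y \<otimes> x) \<in> H"
    using assms by (simp add: rcos_eq_iff subgroup_axioms)
  also have "(x \<otimes> y) \<otimes> inv (y \<otimes> x) = group_commutator G x y"
    using assms by (simp add: group_commutator_def inv_mult_group m_assoc)
  finally show ?thesis .
qed

lemma group_hom_group_commutator:
  assumes "group_hom G H h" "x \<in> carrier G" "y \<in> carrier G"
  shows "h (group_commutator G x y) = group_commutator H (h x) (h y)"
proof -
  interpret group_hom G H h by fact
  show ?thesis using assms(2,3) by (simp add: group_commutator_def)
qed

lemma (in normal) group_hom_rcos: "group_hom G (G Mod H) ((#>) H)"
  by (simp add: group_hom_def group_hom_axioms_def factorgroup_is_group r_coset_hom_Mod is_group)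

text \<open>In the quotient by \<open>N\<close> the assumptions say that \<open>a\<close> becomes
  central and that \<open>b\<close> commutes with \<open>y\<close>, so
  \<open>group_commutator_absorb\<close> applies there.\<close>

lemma (in group) group_commutator_absorb_mod:
  assumes N: "N \<lhd> G"
    and c: "a \<in> carrier G" "b \<in> carrier G" "y \<in> carrier G" "z \<in> carrier G"
    and a: "\<And>u. u \<in> carrier G \<Longrightarrow> group_commutator G a u \<in> N"
    and b: "group_commutator G b y \<in> N"
  shows "N #> group_commutator G (a \<otimes> y) (z \<otimes> b) = N #> group_commutator G y z"
proof -
  interpret N: normal N G by fact
  interpret Q: group "G Mod N" by (rule N.factorgroup_is_group)
  let ?p = "(#>) N"
  have cl: "?p x \<in> carrier (G Mod N)" if "x \<in> carrier G" for x
    using that by (simp add: carrier_FactGroup)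
  have "group_commutator (G Mod N) (?p a \<otimes>\<^bsub>G Mod N\<^esub> ?p y) (?p z \<otimes>\<^bsub>G Mod N\<^esub> ?p b)
      = group_commutator (G Mod N) (?p y) (?p z)"
  proof (rule Q.group_commutator_absorb)
    fix u assume "u \<in> carrier (G Mod N)"
    then obtain v where "v \<in> carrier G" "u = ?p v" by (auto simp: carrier_FactGroup)
    then show "?p a \<otimes>\<^bsub>G Mod N\<^esub> u = u \<otimes>\<^bsub>G Mod N\<^esub> ?p a"
      using c a N.rcos_group_commutator_eq[of a v] by simp
  qed (use c b in \<open>auto simp: cl N.rcos_group_commutator_eq\<close>)
  then show ?thesis
    using c by (simp add: group_hom_group_commutator[OF N.group_hom_rcos] N.rcos_sum)
qed

section \<open>Filtrations\<close>

locale filtered_group = group G for G (structure) +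
  fixes K :: "nat \<Rightarrow> 'a set"
  assumes subgroup_K: "s \<ge> 1 \<Longrightarrow> subgroup (K s) G"
    and K_1: "K 1 = carrier G"
    and K_Suc_subset: "s \<ge> 1 \<Longrightarrow> K (Suc s) \<subseteq> K s"
    and group_commutator_K: "\<lbrakk>s \<ge> 1; t \<ge> 1; x \<in> K s; y \<in> K t\<rbrakk> \<Longrightarrow> group_commutator G x y \<in> K (s + t)"
begin

lemma K_antimono:
  assumes "1 \<le> s" "s \<le> t"
  shows "K t \<subseteq> K s"
  using assms(2,1)
proof (induction t rule: dec_induct)
  case (step n)
  then show ?case using K_Suc_subset[of n] by auto
qed auto

lemma K_carrier: "s \<ge> 1 \<Longrightarrow> x \<in> K s \<Longrightarrow> x \<in> carrier G"
  using subgroup_K subgroup.subset by blast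

text \<open>As \<open>K 1\<close> is the whole group, (G, K s) lies in K (s + 1) and hence in K s;
  and g h g^-1 is (g, h) h.\<close>

lemma normal_K:
  assumes "s \<ge> 1"
  shows "K s \<lhd> G"
proof -
  interpret S: subgroup "K s" G using subgroup_K assms by simp
  show ?thesis
  proof (subst normal_inv_iff, intro conjI ballI)
    fix g h assume g: "g \<in> carrier G" and h: "h \<in> K s"
    have "group_commutator G g h \<in> K s"
      using group_commutator_K[of 1 s g h] g h assms K_1 K_Suc_subset[of s] by auto
    moreover have "g \<otimes> h \<otimes> inv g = group_commutator G g h \<otimes> h"
      using g h by (simp add: group_commutator_def m_assoc)
    ultimately show "g \<otimes> h \<otimes> inv g \<in> K s"
      using h by simp
  qed (simp add: S.subgroup_axioms)
qed

end

section \<open>The lower central series\<close>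

context group begin

text \<open>The two claims need each other. Conjugating h uses that h lies in the preceding term,
  since g h g^-1 is the inverse of (h, g) times h; the inclusion of the next term writes (h, k) as h
  times a conjugate of its inverse and uses normality. Starting at \<open>Suc s\<close> steps around
  the dummy value at 0.\<close>

lemma normal_lower_central_Suc: "lower_central G (Suc s) \<lhd> G"
  and lower_central_Suc_subset: "lower_central G (Suc (Suc s)) \<subseteq> lower_central G (Suc s)"
proof (induction s)
  case 0
  {
    case 1 show ?case by (simp add: normal_self)
  next
    case 2 show ?case
      unfolding lower_central.simps commutator_subgroup_def
      by (intro generate_incl) (auto intro: group_commutator_closed)
  }
next
  case (Suc s)
  let ?\<Gamma> = "lower_central G"
  interpret N: normal "?\<Gamma> (Suc s)" G by (rule Suc.IH)
  have gen: "{group_commutator G h k |h k. h \<in> ?\<Gamma> (Suc s) \<and> k \<in> carrier G} \<subseteq> carrier G"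
    using N.subset by (auto intro!: group_commutator_closed)
  have sub: "subgroup (?\<Gamma> (Suc (Suc s))) G"
    unfolding lower_central.simps commutator_subgroup_def by (intro generate_is_subgroup gen)
  then interpret S: subgroup "?\<Gamma> (Suc (Suc s))" G .
  show norm: "?\<Gamma> (Suc (Suc s)) \<lhd> G"
  proof (subst normal_inv_iff, intro conjI ballI)
    fix g h assume g: "g \<in> carrier G" and h: "h \<in> ?\<Gamma> (Suc (Suc s))"
    then have "h \<in> ?\<Gamma> (Suc s)" using Suc.IH by blast
    then have "group_commutator G h g \<in> ?\<Gamma> (Suc (Suc s))"
      using g unfolding lower_central.simps commutator_subgroup_def by (auto intro: generate.incl)
    then have "inv (group_commutator G h g) \<in> ?\<Gamma> (Suc (Suc s))" by simp
    moreover have "g \<otimes> h \<otimes> inv g = inv (group_commutator G h g) \<otimes> h"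
      using g h by (simp add: group_commutator_def inv_mult_group m_assoc)
    ultimately show "g \<otimes> h \<otimes> inv g \<in> ?\<Gamma> (Suc (Suc s))"
      using h by simp
  qed (rule sub)
  interpret N': normal "?\<Gamma> (Suc (Suc s))" G by (rule norm)
  show "?\<Gamma> (Suc (Suc (Suc s))) \<subseteq> ?\<Gamma> (Suc (Suc s))"
    unfolding lower_central.simps(3)[of G "Suc s"] commutator_subgroup_def
  proof (rule generate_subgroup_incl[OF _ sub], clarify)
    fix h k assume hk: "h \<in> ?\<Gamma> (Suc (Suc s))" "k \<in> carrier G"
    then have "group_commutator G h k = h \<otimes> (k \<otimes> inv h \<otimes> inv k)"
      by (simp add: group_commutator_def m_assoc)
    then show "group_commutator G h k \<in> ?\<Gamma> (Suc (Suc s))"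
      using hk N'.inv_op_closed2 by simp
  qed
qed

lemma normal_lower_central: "s \<ge> 1 \<Longrightarrow> lower_central G s \<lhd> G"
  using normal_lower_central_Suc[of "s - 1"] by simp

lemma subgroup_lower_central: "s \<ge> 1 \<Longrightarrow> subgroup (lower_central G s) G"
  using normal_lower_central normal_imp_subgroup by blast

lemma lower_central_carrier: "s \<ge> 1 \<Longrightarrow> x \<in> lower_central G s \<Longrightarrow> x \<in> carrier G"
  using subgroup_lower_central subgroup.subset by blast

lemma lower_central_subset: "s \<ge> 1 \<Longrightarrow> lower_central G (Suc s) \<subseteq> lower_central G s"
  using lower_central_Suc_subset[of "s - 1"] by simp

lemma group_commutator_lower_central:
  "\<lbrakk>s \<ge> 1; x \<in> lower_central G s; y \<in> carrier G\<rbrakk> \<Longrightarrow> group_commutator G x y \<in> lower_central G (Suc s)"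
  by (cases s) (auto simp: lower_central.simps(3) commutator_subgroup_def intro: generate.incl)

end

section \<open>Automorphisms\<close>

text \<open>The restriction to the carrier is there because elements of \<open>AutoGroup\<close> are
  extensional functions.\<close>

definition inner_aut :: "('a, 'b) monoid_scheme \<Rightarrow> 'a \<Rightarrow> 'a \<Rightarrow> 'a" where
  "inner_aut G g = (\<lambda>x \<in> carrier G. g \<otimes>\<^bsub>G\<^esub> x \<otimes>\<^bsub>G\<^esub> inv\<^bsub>G\<^esub> g)"

lemma inner_automorphisms_eq: "inner_automorphisms G = inner_aut G ` carrier G"
  by (simp add: inner_automorphisms_def inner_aut_def image_def)

lemma carrier_AutoGroup: "carrier (AutoGroup G) = auto G"
  by (simp add: AutoGroup_def)

lemma one_AutoGroup: "\<one>\<^bsub>AutoGroup G\<^esub> = (\<lambda>x \<in> carrier G. x)"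
  by (simp add: AutoGroup_def BijGroup_def)

lemma mult_AutoGroup:
  assumes "\<alpha> \<in> carrier (AutoGroup G)" "\<beta> \<in> carrier (AutoGroup G)"
  shows "\<alpha> \<otimes>\<^bsub>AutoGroup G\<^esub> \<beta> = compose (carrier G) \<alpha> \<beta>"
  using assms by (simp add: AutoGroup_def BijGroup_def auto_def)

lemma mult_AutoGroup_apply:
  assumes "\<alpha> \<in> carrier (AutoGroup G)" "\<beta> \<in> carrier (AutoGroup G)" "x \<in> carrier G"
  shows "(\<alpha> \<otimes>\<^bsub>AutoGroup G\<^esub> \<beta>) x = \<alpha> (\<beta> x)"
  using assms by (simp add: mult_AutoGroup compose_def)

lemma AutoGroup_eqI:
  assumes "\<alpha> \<in> carrier (AutoGroup G)" "\<beta> \<in> carrier (AutoGroup G)"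
    "\<And>x. x \<in> carrier G \<Longrightarrow> \<alpha> x = \<beta> x"
  shows "\<alpha> = \<beta>"
  using assms unfolding carrier_AutoGroup auto_def Bij_def by (blast intro: extensionalityI)

lemma AutoGroup_hom: "\<alpha> \<in> carrier (AutoGroup G) \<Longrightarrow> \<alpha> \<in> hom G G"
  by (simp add: carrier_AutoGroup auto_def)

lemma AutoGroup_closed: "\<alpha> \<in> carrier (AutoGroup G) \<Longrightarrow> x \<in> carrier G \<Longrightarrow> \<alpha> x \<in> carrier G"
  using AutoGroup_hom hom_in_carrier by metis

lemma AutoGroup_surj:
  assumes "\<alpha> \<in> carrier (AutoGroup G)" "x \<in> carrier G"
  obtains y where "y \<in> carrier G" "\<alpha> y = x"
proof -
  have "x \<in> \<alpha> ` carrier G"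
    using assms by (simp add: carrier_AutoGroup auto_def Bij_def bij_betw_def)
  with that show thesis by blast
qed

context group begin

lemma group_hom_AutoGroup: "\<alpha> \<in> carrier (AutoGroup G) \<Longrightarrow> group_hom G G \<alpha>"
  by (simp add: group_hom_def group_hom_axioms_def AutoGroup_hom is_group)

lemma inner_aut_apply: "x \<in> carrier G \<Longrightarrow> inner_aut G g x = g \<otimes> x \<otimes> inv g"
  by (simp add: inner_aut_def)

lemma inner_aut_in_AutoGroup:
  assumes g: "g \<in> carrier G"
  shows "inner_aut G g \<in> carrier (AutoGroup G)"
proof -
  have "inner_aut G g \<in> hom G G"
    using g by (auto simp: hom_def inner_aut_def m_assoc)
  moreover have "bij_betw (inner_aut G g) (carrier G) (carrier G)"
  proof (rule bij_betw_byWitness[where f' = "inner_aut G (inv g)"])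
    show "\<forall>x \<in> carrier G. inner_aut G (inv g) (inner_aut G g x) = x"
      "\<forall>x \<in> carrier G. inner_aut G g (inner_aut G (inv g) x) = x"
      using g by (simp_all add: inner_aut_def m_assoc)
    show "inner_aut G g ` carrier G \<subseteq> carrier G" "inner_aut G (inv g) ` carrier G \<subseteq> carrier G"
      using g by (auto simp: inner_aut_def)
  qed
  ultimately show ?thesis
    by (simp add: carrier_AutoGroup auto_def Bij_def inner_aut_def)
qed

lemma inner_aut_mult:
  assumes "g \<in> carrier G" "h \<in> carrier G"
  shows "inner_aut G (g \<otimes> h) = inner_aut G g \<otimes>\<^bsub>AutoGroup G\<^esub> inner_aut G h"
proof (rule AutoGroup_eqI)
  interpret A: group "AutoGroup G" by (rule AutoGroup)
  show "inner_aut G g \<otimes>\<^bsub>AutoGroup G\<^esub> inner_aut G h \<in> carrier (AutoGroup G)"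
    using assms by (simp add: inner_aut_in_AutoGroup)
qed (use assms in \<open>auto simp: inner_aut_in_AutoGroup mult_AutoGroup_apply inner_aut_apply m_assoc inv_mult_group\<close>)

lemma group_hom_inner_aut: "group_hom G (AutoGroup G) (inner_aut G)"
  by (simp add: group_hom_def group_hom_axioms_def AutoGroup is_group hom_def
      inner_aut_mult inner_aut_in_AutoGroup)

text \<open>This is the bridge between automorphisms and commutators: a bound on displacements
  \<alpha>(x) x^-1 becomes, for conjugations, a bound on commutators.\<close>

lemma inner_aut_displacement:
  "\<lbrakk>g \<in> carrier G; x \<in> carrier G\<rbrakk> \<Longrightarrow> inner_aut G g x \<otimes> inv x = group_commutator G g x"
  by (simp add: inner_aut_apply group_commutator_def)

lemma AutoGroup_conj_inner_aut:
  assumes "\<alpha> \<in> carrier (AutoGroup G)" "g \<in> carrier G"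
  shows "\<alpha> \<otimes>\<^bsub>AutoGroup G\<^esub> inner_aut G g = inner_aut G (\<alpha> g) \<otimes>\<^bsub>AutoGroup G\<^esub> \<alpha>"
proof (rule AutoGroup_eqI)
  interpret A: group "AutoGroup G" by (rule AutoGroup)
  interpret h: group_hom G G \<alpha> using assms by (simp add: group_hom_AutoGroup)
  show "\<alpha> \<otimes>\<^bsub>AutoGroup G\<^esub> inner_aut G g \<in> carrier (AutoGroup G)"
    "inner_aut G (\<alpha> g) \<otimes>\<^bsub>AutoGroup G\<^esub> \<alpha> \<in> carrier (AutoGroup G)"
    using assms by (simp_all add: inner_aut_in_AutoGroup)
qed (use assms in \<open>simp add: inner_aut_in_AutoGroup mult_AutoGroup_apply inner_aut_apply
     AutoGroup_closed group_hom.hom_inv[OF group_hom_AutoGroup] hom_mult[OF AutoGroup_hom]\<close>)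

lemma normal_inner_automorphisms: "inner_automorphisms G \<lhd> AutoGroup G"
proof -
  interpret A: group "AutoGroup G" by (rule AutoGroup)
  interpret i: group_hom G "AutoGroup G" "inner_aut G" by (rule group_hom_inner_aut)
  show ?thesis
    unfolding inner_automorphisms_eq
  proof (subst A.normal_inv_iff, intro conjI ballI)
    show "subgroup (inner_aut G ` carrier G) (AutoGroup G)" by (rule i.img_is_subgroup)
    fix \<alpha> \<beta> assume \<alpha>: "\<alpha> \<in> carrier (AutoGroup G)" and "\<beta> \<in> inner_aut G ` carrier G"
    then obtain g where g: "g \<in> carrier G" "\<beta> = inner_aut G g" by auto
    then have "\<alpha> \<otimes>\<^bsub>AutoGroup G\<^esub> \<beta> \<otimes>\<^bsub>AutoGroup G\<^esub> inv\<^bsub>AutoGroup G\<^esub> \<alpha> = inner_aut G (\<alpha> g)"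
      using \<alpha> by (simp add: AutoGroup_conj_inner_aut inner_aut_in_AutoGroup AutoGroup_closed A.m_assoc)
    then show "\<alpha> \<otimes>\<^bsub>AutoGroup G\<^esub> \<beta> \<otimes>\<^bsub>AutoGroup G\<^esub> inv\<^bsub>AutoGroup G\<^esub> \<alpha> \<in> inner_aut G ` carrier G"
      using \<alpha> g by (simp add: AutoGroup_closed)
  qed
qed

lemma johnson_filtrationI:
  "\<lbrakk>\<alpha> \<in> carrier (AutoGroup G); \<And>x. x \<in> carrier G \<Longrightarrow> \<alpha> x \<otimes> inv x \<in> lower_central G (Suc s)\<rbrakk>
   \<Longrightarrow> \<alpha> \<in> johnson_filtration G s"
  by (simp add: johnson_filtration_def)

lemma johnson_filtration_AutoGroup: "\<alpha> \<in> johnson_filtration G s \<Longrightarrow> \<alpha> \<in> carrier (AutoGroup G)"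
  by (simp add: johnson_filtration_def)

lemma inner_aut_in_johnson_filtration:
  assumes "s \<ge> 1" "g \<in> lower_central G s"
  shows "inner_aut G g \<in> johnson_filtration G s"
  using assms
  by (intro johnson_filtrationI)
    (auto simp: inner_aut_in_AutoGroup lower_central_carrier inner_aut_displacement
      group_commutator_lower_central)

text \<open>
  The inductive step needs \<open>(\<Gamma>\<^bsup>s+1\<^esup>, \<Gamma>\<^sup>t) \<subseteq> \<Gamma>\<^bsup>s+t+1\<^esup>\<close>, which is the induction hypothesis for
  inner automorphisms; this replaces the three subgroups lemma.
\<close>

lemma johnson_filtration_shift:
  assumes "t \<ge> 1" "\<alpha> \<in> johnson_filtration G s" "x \<in> lower_central G t"
  shows "\<alpha> x \<otimes> inv x \<in> lower_central G (s + t)"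
  using assms
proof (induction t arbitrary: s \<alpha> x rule: dec_induct)
  case base
  then show ?case by (simp add: johnson_filtration_def)
next
  case (step t)
  let ?\<Gamma> = "lower_central G" and ?N = "lower_central G (s + Suc t)"
  interpret N: normal ?N G by (simp add: normal_lower_central)
  interpret h: group_hom G G \<alpha>
    using step.prems johnson_filtration_AutoGroup group_hom_AutoGroup by blast
  interpret p: group_hom G "G Mod ?N" "(#>) ?N" by (rule N.group_hom_rcos)
  have com: "group_commutator G b y \<in> ?N" if "b \<in> ?\<Gamma> (Suc s)" "y \<in> ?\<Gamma> t" for b y
  proof -
    have "inner_aut G b y \<otimes> inv y \<in> ?\<Gamma> (Suc s + t)"
      using that by (intro step.IH inner_aut_in_johnson_filtration) auto
    then show ?thesis
      using that lower_central_carrier[of "Suc s" b] lower_central_carrier[of t y] step.hyps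
      by (simp add: inner_aut_displacement)
  qed
  have gens: "?N #> \<alpha> (group_commutator G y z) = ?N #> group_commutator G y z"
    if y: "y \<in> ?\<Gamma> t" and z: "z \<in> carrier G" for y z
  proof -
    have yc: "y \<in> carrier G" using y step.hyps lower_central_carrier by blast
    \<comment> \<open>The displacement of \<open>y\<close> is split off on the left and that of
      \<open>z\<close> on the right, so that \<alpha> maps (y, z) to (a y, z b), the shape that
      \<open>group_commutator_absorb_mod\<close> expects. Here \<open>a\<close> lies in
      \<Gamma>^(s+t) and is central modulo \<open>?N\<close>, and \<open>b\<close> commutes with
      \<open>y\<close> modulo \<open>?N\<close> by \<open>com\<close>.\<close>
    define a where "a = \<alpha> y \<otimes> inv y"
    define b where "b = inv z \<otimes> \<alpha> z"
    have abc: "a \<in> carrier G" "b \<in> carrier G" using yc z by (simp_all add: a_def b_def)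
    have "a \<in> ?\<Gamma> (s + t)" using step.IH[OF step.prems(1) y] by (simp add: a_def)
    then have aN: "group_commutator G a u \<in> ?N" if "u \<in> carrier G" for u
      using group_commutator_lower_central[of "s + t" a u] that step.hyps by simp
    have b: "b \<in> ?\<Gamma> (Suc s)"
    proof -
      interpret M: normal "?\<Gamma> (Suc s)" G by (rule normal_lower_central_Suc)
      have "\<alpha> z \<otimes> inv z \<in> ?\<Gamma> (Suc s)" using step.prems(1) z by (simp add: johnson_filtration_def)
      \<comment> \<open>Conjugation by \<open>z\<close> turns the left displacement, which the
        definition of F^s controls, into the right one.\<close>
      then have "inv z \<otimes> (\<alpha> z \<otimes> inv z) \<otimes> z \<in> ?\<Gamma> (Suc s)" using z M.inv_op_closed1 by blast
      then show ?thesis using z by (simp add: b_def m_assoc)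
    qed
    have "\<alpha> (group_commutator G y z) = group_commutator G (a \<otimes> y) (z \<otimes> b)"
      using yc z
      by (simp add: group_hom_group_commutator[OF h.group_hom_axioms] a_def b_def m_assoc)
    then show ?thesis
      using group_commutator_absorb_mod[OF N.normal_axioms abc yc z aN com[OF b y]] by simp
  qed
  have xc: "x \<in> carrier G" using step.prems lower_central_carrier[of "Suc t" x] by simp
  let ?S = "{group_commutator G h k |h k. h \<in> ?\<Gamma> t \<and> k \<in> carrier G}"
  have Sc: "?S \<subseteq> carrier G" using step.hyps lower_central_carrier[of t] by auto
  have "x \<in> generate G ?S"
    using step.prems(2) step.hyps by (cases t) (auto simp: lower_central.simps(3) commutator_subgroup_def)
  \<comment> \<open>Followed by the projection, \<alpha> and the identity are two homomorphisms to
    the quotient by \<open>?N\<close>; agreeing on the generating commutators, they agree on all of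
    \<Gamma>^(t+1).\<close>
  then have "?N #> \<alpha> x = ?N #> x"
  proof (induction x rule: generate.induct)
    case one
    then show ?case by simp
  next
    case (incl x)
    then show ?case using gens by auto
  next
    case (inv x)
    then have "?N #> \<alpha> x = ?N #> x" "x \<in> carrier G" using gens subsetD[OF Sc] by blast+
    then show ?case
      using p.hom_inv[of x] p.hom_inv[of "\<alpha> x"] by (simp del: p.hom_inv)
  next
    case (eng x y)
    then have "x \<in> carrier G" "y \<in> carrier G" using generate_in_carrier[OF Sc] by auto
    then show ?case
      using eng.IH p.hom_mult[of x y] p.hom_mult[of "\<alpha> x" "\<alpha> y"] by (simp del: p.hom_mult)
  qed
  then show ?case
    using xc rcos_eq_iff[OF N.subgroup_axioms, of "\<alpha> x" x] by simp
qed

text \<open>The commutator (x, y) is the displacement of y under conjugation by x, and this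
  conjugation lies in F^s when x lies in \<Gamma>^s.\<close>

lemma filtered_group_lower_central: "filtered_group G (lower_central G)"
proof (intro filtered_group.intro filtered_group_axioms.intro)
  fix s t x y assume *: "s \<ge> (1::nat)" "t \<ge> (1::nat)" "x \<in> lower_central G s" "y \<in> lower_central G t"
  then have "inner_aut G x y \<otimes> inv y \<in> lower_central G (s + t)"
    by (intro johnson_filtration_shift inner_aut_in_johnson_filtration)
  with * show "group_commutator G x y \<in> lower_central G (s + t)"
    using lower_central_carrier[of s x] lower_central_carrier[of t y]
    by (simp add: inner_aut_displacement)
qed (use subgroup_lower_central lower_central_subset is_group in auto)

end

text \<open>Minimality of the lower central series: by induction, each generator of its next term is
  a commutator of an element of \<open>K s\<close> with one of \<open>K 1\<close>.\<close>

lemma (in filtered_group) lower_central_subset_K: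
  "s \<ge> 1 \<Longrightarrow> lower_central G s \<subseteq> K s"
proof (induction s rule: dec_induct)
  case base
  then show ?case using K_1 by simp
next
  case (step s)
  have "generate G {group_commutator G h k |h k. h \<in> lower_central G s \<and> k \<in> carrier G} \<subseteq> K (Suc s)"
  proof (rule generate_subgroup_incl)
    show "{group_commutator G h k |h k. h \<in> lower_central G s \<and> k \<in> carrier G} \<subseteq> K (Suc s)"
      using group_commutator_K[of s 1] step K_1 by auto
  qed (simp add: subgroup_K)
  then show ?case
    using step.hyps by (cases s) (auto simp: lower_central.simps(3) commutator_subgroup_def)
qed

section \<open>Filtrations and lower central series under homomorphisms\<close>

lemma filtered_group_img:
  assumes "filtered_group G K" "group_hom G H h" "h ` carrier G = carrier H"
  shows "filtered_group H (\<lambda>s. h ` K s)"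
proof -
  interpret filtered_group G K by fact
  interpret h: group_hom G H h by fact
  show ?thesis
  proof (intro filtered_group.intro filtered_group_axioms.intro)
    fix s t x y assume *: "s \<ge> (1::nat)" "t \<ge> (1::nat)" "x \<in> h ` K s" "y \<in> h ` K t"
    then obtain a b where ab: "a \<in> K s" "b \<in> K t" "x = h a" "y = h b" by blast
    then have "h (group_commutator G a b) = group_commutator H x y"
      using * K_carrier group_hom_group_commutator[OF h.group_hom_axioms] by metis
    then show "group_commutator H x y \<in> h ` K (s + t)"
      using group_commutator_K[OF *(1,2) ab(1,2)] by force
  next
    fix s :: nat assume s: "s \<ge> 1"
    show "subgroup (h ` K s) H" using s by (intro h.subgroup_img_is_subgroup subgroup_K)
    show "h ` K (Suc s) \<subseteq> h ` K s" using K_Suc_subset[OF s] by blast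
  qed (use assms(3) K_1 in \<open>auto simp: h.H.is_group\<close>)
qed

lemma (in group_hom) lower_central_img_subset: "h ` lower_central G s \<subseteq> lower_central H s"
proof (cases s)
  case 0
  then show ?thesis by auto
next
  case (Suc n)
  have "h ` lower_central G (Suc n) \<subseteq> lower_central H (Suc n)"
  proof (induction n)
    case 0
    then show ?case by auto
  next
    case (Suc n)
    let ?S = "{group_commutator G x y |x y. x \<in> lower_central G (Suc n) \<and> y \<in> carrier G}"
    have c: "x \<in> carrier G" if "x \<in> lower_central G (Suc n)" for x
      using that G.lower_central_carrier[of "Suc n"] by simp
    have "h ` lower_central G (Suc (Suc n)) = generate H (h ` ?S)"
      unfolding lower_central.simps(3) commutator_subgroup_def
      by (rule generate_img[symmetric]) (use c in auto)
    also have "\<dots> \<subseteq> lower_central H (Suc (Suc n))"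
    proof (rule H.generate_subgroup_incl)
      show "h ` ?S \<subseteq> lower_central H (Suc (Suc n))"
        using c subsetD[OF Suc imageI] group_hom_group_commutator[OF group_hom_axioms]
        by (auto intro!: H.group_commutator_lower_central)
    qed (rule H.subgroup_lower_central, simp)
    finally show ?case .
  qed
  then show ?thesis using Suc by simp
qed

text \<open>By surjectivity the images of the terms form a filtration of \<open>H\<close>, and the
  lower central series of \<open>H\<close> is contained in every such filtration.\<close>

lemma (in group_hom) lower_central_img:
  assumes "h ` carrier G = carrier H" "s \<ge> 1"
  shows "h ` lower_central G s = lower_central H s"
proof
  show "lower_central H s \<subseteq> h ` lower_central G s"
    using filtered_group.lower_central_subset_K[OF
        filtered_group_img[OF G.filtered_group_lower_central group_hom_axioms assms(1)] assms(2)] .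
qed (rule lower_central_img_subset)

lemma (in group) group_commutator_restrict_carrier:
  assumes "subgroup H G" "x \<in> H" "y \<in> H"
  shows "group_commutator (G\<lparr>carrier := H\<rparr>) x y = group_commutator G x y"
  using assms by (simp add: group_commutator_def m_inv_consistent)

section \<open>The Johnson filtrations of the Torelli group and of its outer quotient\<close>

context group begin

text \<open>For a product, insert \<beta>(x)^-1 \<beta>(x) between \<alpha>(\<beta>(x)) and x^-1.
  For the inverse, write x = \<alpha>(y): its displacement of x is the inverse of the displacement
  of y by \<alpha>.\<close>

lemma subgroup_johnson_filtration: "subgroup (johnson_filtration G s) (AutoGroup G)"
proof -
  interpret A: group "AutoGroup G" by (rule AutoGroup)
  interpret N: normal "lower_central G (Suc s)" G by (rule normal_lower_central_Suc)
  show ?thesis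
  proof
    show "johnson_filtration G s \<subseteq> carrier (AutoGroup G)"
      by (auto simp: johnson_filtration_def)
    show "\<one>\<^bsub>AutoGroup G\<^esub> \<in> johnson_filtration G s"
      by (auto intro!: johnson_filtrationI A.one_closed) (simp add: one_AutoGroup)
    fix \<alpha> assume \<alpha>: "\<alpha> \<in> johnson_filtration G s"
    then have \<alpha>A: "\<alpha> \<in> carrier (AutoGroup G)" by (rule johnson_filtration_AutoGroup)
    {
      fix \<beta> assume \<beta>: "\<beta> \<in> johnson_filtration G s"
      then have \<beta>A: "\<beta> \<in> carrier (AutoGroup G)" by (rule johnson_filtration_AutoGroup)
      show "\<alpha> \<otimes>\<^bsub>AutoGroup G\<^esub> \<beta> \<in> johnson_filtration G s"
      proof (rule johnson_filtrationI)
        fix x assume x: "x \<in> carrier G"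
        then have c: "\<beta> x \<in> carrier G" "\<alpha> (\<beta> x) \<in> carrier G"
          using \<alpha>A \<beta>A by (simp_all add: AutoGroup_closed)
        have "(\<alpha> (\<beta> x) \<otimes> inv (\<beta> x)) \<otimes> (\<beta> x \<otimes> inv x) \<in> lower_central G (Suc s)"
          using \<alpha> \<beta> x c by (auto simp: johnson_filtration_def)
        then show "(\<alpha> \<otimes>\<^bsub>AutoGroup G\<^esub> \<beta>) x \<otimes> inv x \<in> lower_central G (Suc s)"
          using x c \<alpha>A \<beta>A by (simp add: mult_AutoGroup_apply m_assoc)
      qed (use \<alpha>A \<beta>A in simp)
    }
    let ?\<gamma> = "inv\<^bsub>AutoGroup G\<^esub> \<alpha>"
    show "?\<gamma> \<in> johnson_filtration G s"
    proof (rule johnson_filtrationI)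
      fix x assume x: "x \<in> carrier G"
      then obtain y where y: "y \<in> carrier G" "\<alpha> y = x"
        using AutoGroup_surj[OF \<alpha>A] by metis
      have "y = (?\<gamma> \<otimes>\<^bsub>AutoGroup G\<^esub> \<alpha>) y"
        using \<alpha>A y by (simp add: one_AutoGroup)
      also have "\<dots> = ?\<gamma> (\<alpha> y)"
        by (rule mult_AutoGroup_apply) (use \<alpha>A y in simp_all)
      finally have \<gamma>x: "?\<gamma> x = y" using y by simp
      have "inv (x \<otimes> inv y) \<in> lower_central G (Suc s)"
        using \<alpha> y by (auto simp: johnson_filtration_def)
      then show "?\<gamma> x \<otimes> inv x \<in> lower_central G (Suc s)"
        using x y by (simp add: \<gamma>x inv_mult_group)
    qed (use \<alpha>A in simp)
  qed
qed

text \<open>At x = \<beta>(\<alpha>(y)) the commutator takes the value \<alpha>(\<beta>(y)), so no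
  inverse automorphism has to be evaluated. With \<alpha>(y) = a y and \<beta>(y) = b y, the
  elements \<alpha>(b) a y and \<beta>(a) b y agree modulo \<Gamma>^(s+t+1): at that level \<alpha>
  fixes b, \<beta> fixes a, and a commutes with b.\<close>

lemma johnson_filtration_group_commutator:
  assumes "s \<ge> 1" "t \<ge> 1" and \<alpha>: "\<alpha> \<in> johnson_filtration G s" and \<beta>: "\<beta> \<in> johnson_filtration G t"
  shows "group_commutator (AutoGroup G) \<alpha> \<beta> \<in> johnson_filtration G (s + t)"
proof (rule johnson_filtrationI)
  interpret A: group "AutoGroup G" by (rule AutoGroup)
  interpret \<Gamma>: filtered_group G "lower_central G" by (rule filtered_group_lower_central)
  let ?N = "lower_central G (Suc (s + t))"
  interpret N: normal ?N G by (rule normal_lower_central_Suc)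
  interpret p: group_hom G "G Mod ?N" "(#>) ?N" by (rule N.group_hom_rcos)
  have A: "\<alpha> \<in> carrier (AutoGroup G)" "\<beta> \<in> carrier (AutoGroup G)"
    using \<alpha> \<beta> johnson_filtration_AutoGroup by blast+
  then show "group_commutator (AutoGroup G) \<alpha> \<beta> \<in> carrier (AutoGroup G)" by simp
  have mod: "?N #> \<xi> b = ?N #> b" if "\<xi> \<in> johnson_filtration G i" "b \<in> lower_central G j"
      "i + j = Suc (s + t)" "j \<ge> 1" for \<xi> b i j
  proof -
    have "b \<in> carrier G" using that lower_central_carrier by blast
    moreover have "\<xi> b \<in> carrier G"
      using AutoGroup_closed[OF johnson_filtration_AutoGroup] that(1) calculation by simp
    ultimately show ?thesis
      using johnson_filtration_shift[of j \<xi> i b] that by (simp add: rcos_eq_iff N.subgroup_axioms)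
  qed
  fix x assume "x \<in> carrier G"
  then obtain z where z: "z \<in> carrier G" "\<beta> z = x" using AutoGroup_surj[OF A(2)] by metis
  obtain y where y: "y \<in> carrier G" "\<alpha> y = z" using AutoGroup_surj[OF A(1) z(1)] by metis
  have "group_commutator (AutoGroup G) \<alpha> \<beta> x =
      (group_commutator (AutoGroup G) \<alpha> \<beta> \<otimes>\<^bsub>AutoGroup G\<^esub> (\<beta> \<otimes>\<^bsub>AutoGroup G\<^esub> \<alpha>)) y"
    using A y z by (simp add: mult_AutoGroup_apply)
  also have "\<dots> = \<alpha> (\<beta> y)"
    using A y by (simp add: A.group_commutator_mult_swap mult_AutoGroup_apply)
  finally have eq: "group_commutator (AutoGroup G) \<alpha> \<beta> x = \<alpha> (\<beta> y)" .
  define a where "a = \<alpha> y \<otimes> inv y"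
  define b where "b = \<beta> y \<otimes> inv y"
  have cl: "\<alpha> u \<in> carrier G" "\<beta> u \<in> carrier G" if "u \<in> carrier G" for u
    using that A by (simp_all add: AutoGroup_closed)
  have ab: "a \<in> lower_central G (Suc s)" "b \<in> lower_central G (Suc t)"
    using \<alpha> \<beta> y by (auto simp: a_def b_def johnson_filtration_def)
  have abc: "a \<in> carrier G" "b \<in> carrier G" using cl[OF y(1)] y(1) by (simp_all add: a_def b_def)
  have ay: "\<alpha> y = a \<otimes> y" "\<beta> y = b \<otimes> y" using cl[OF y(1)] y(1) by (simp_all add: a_def b_def m_assoc)
  have "group_commutator G b a \<in> lower_central G (Suc (Suc (s + t)))"
    using \<Gamma>.group_commutator_K[OF _ _ ab(2,1)] by (simp add: add.commute)
  then have com: "(?N #> b) <#> (?N #> a) = (?N #> a) <#> (?N #> b)"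
    using abc lower_central_Suc_subset N.rcos_group_commutator_eq by blast
  have "?N #> \<alpha> (\<beta> y) = ?N #> (\<alpha> b \<otimes> (a \<otimes> y))"
    by (simp only: ay(2) hom_mult[OF AutoGroup_hom[OF A(1)] abc(2) y(1)] ay(1))
  also have "\<dots> = (?N #> b) <#> ((?N #> a) <#> (?N #> y))"
    using N.rcos_sum[OF cl(1)[OF abc(2)] m_closed[OF abc(1) y(1)]]
    by (simp only: mod[OF \<alpha> ab(2)] N.rcos_sum[OF abc(1) y(1)])
  also have "\<dots> = ((?N #> b) <#> (?N #> a)) <#> (?N #> y)"
    using abc y(1) by (simp only: N.rcos_sum m_assoc m_closed)
  also have "\<dots> = ((?N #> a) <#> (?N #> b)) <#> (?N #> y)"
    by (simp only: com)
  also have "\<dots> = (?N #> a) <#> ((?N #> b) <#> (?N #> y))"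
    using abc y(1) by (simp only: N.rcos_sum m_assoc m_closed)
  also have "\<dots> = ?N #> (\<beta> a \<otimes> (b \<otimes> y))"
    using N.rcos_sum[OF cl(2)[OF abc(1)] m_closed[OF abc(2) y(1)]]
    by (simp only: mod[OF \<beta> ab(1)] N.rcos_sum[OF abc(2) y(1)])
  also have "\<dots> = ?N #> \<beta> (\<alpha> y)"
    by (simp only: ay(1) hom_mult[OF AutoGroup_hom[OF A(2)] abc(1) y(1)] ay(2))
  finally have "?N #> \<alpha> (\<beta> y) = ?N #> x" using y z by simp
  then show "group_commutator (AutoGroup G) \<alpha> \<beta> x \<otimes> inv x \<in> lower_central G (Suc (s + t))"
    using eq cl[of x] cl[of y] cl[of "\<beta> y"] cl[of z] y z rcos_eq_iff[OF N.subgroup_axioms, of "\<alpha> (\<beta> y)" x]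
    by auto
qed

lemma group_torelli: "group (torelli G)"
  unfolding torelli_def
  by (rule subgroup.subgroup_is_group[OF subgroup_johnson_filtration AutoGroup])

lemma johnson_filtration_Suc_subset: "johnson_filtration G (Suc s) \<subseteq> johnson_filtration G s"
  using lower_central_Suc_subset[of s] by (auto simp: johnson_filtration_def)

lemma filtered_group_johnson: "filtered_group (torelli G) (johnson_filtration G)"
proof (intro filtered_group.intro filtered_group_axioms.intro)
  interpret A: group "AutoGroup G" by (rule AutoGroup)
  have sub1: "johnson_filtration G s \<subseteq> johnson_filtration G 1" if "s \<ge> 1" for s
    using that
  proof (induction s rule: dec_induct)
    case (step s)
    then show ?case using johnson_filtration_Suc_subset by blast
  qed simp
  fix s assume s: "s \<ge> (1::nat)"
  show "subgroup (johnson_filtration G s) (torelli G)"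
    unfolding torelli_def
    using s by (intro A.subgroup_incl subgroup_johnson_filtration sub1)
  show "johnson_filtration G (Suc s) \<subseteq> johnson_filtration G s"
    by (rule johnson_filtration_Suc_subset)
  fix t \<alpha> \<beta> assume *: "t \<ge> (1::nat)" "\<alpha> \<in> johnson_filtration G s" "\<beta> \<in> johnson_filtration G t"
  then have "\<alpha> \<in> johnson_filtration G 1" "\<beta> \<in> johnson_filtration G 1" using s sub1 by blast+
  then show "group_commutator (torelli G) \<alpha> \<beta> \<in> johnson_filtration G (s + t)"
    unfolding torelli_def
    using johnson_filtration_group_commutator[OF s *]
    by (simp add: A.group_commutator_restrict_carrier[OF subgroup_johnson_filtration])
qed (use group_torelli in \<open>simp_all add: torelli_def\<close>)

lemma group_hom_out_proj: "group_hom (torelli G) (outer_torelli G) (out_proj G)"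
  and outer_torelli_carrier: "out_proj G ` carrier (torelli G) = carrier (outer_torelli G)"
proof -
  interpret I: normal "inner_automorphisms G" "AutoGroup G" by (rule normal_inner_automorphisms)
  interpret p: group_hom "AutoGroup G" "OutGroup G" "out_proj G"
    using I.group_hom_rcos by (simp add: OutGroup_def out_proj_def[abs_def])
  have c: "\<alpha> \<in> carrier (AutoGroup G)" if "\<alpha> \<in> johnson_filtration G 1" for \<alpha>
    using that by (rule johnson_filtration_AutoGroup)
  have sub: "subgroup (out_proj G ` johnson_filtration G 1) (OutGroup G)"
    by (intro p.subgroup_img_is_subgroup subgroup_johnson_filtration)
  then have "group (outer_torelli G)"
    unfolding outer_torelli_def outer_johnson_filtration_def
    by (rule subgroup.subgroup_is_group) (rule p.H.is_group)
  moreover have "out_proj G \<in> hom (torelli G) (outer_torelli G)"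
    using p.hom_mult[OF c c]
    by (simp add: hom_def Pi_iff torelli_def outer_torelli_def outer_johnson_filtration_def)
  ultimately show "group_hom (torelli G) (outer_torelli G) (out_proj G)"
    by (simp add: group_hom_def group_hom_axioms_def group_torelli)
qed (simp add: torelli_def outer_torelli_def outer_johnson_filtration_def)

lemma filtered_group_outer_johnson:
  "filtered_group (outer_torelli G) (outer_johnson_filtration G)"
  using filtered_group_img[OF filtered_group_johnson group_hom_out_proj outer_torelli_carrier]
  by (simp add: outer_johnson_filtration_def[abs_def])

lemma lower_central_outer_torelli:
  "s \<ge> 1 \<Longrightarrow> lower_central (outer_torelli G) s = out_proj G ` lower_central (torelli G) s"
  using group_hom.lower_central_img[OF group_hom_out_proj outer_torelli_carrier] by simp

end

section \<open>The graded group of a filtration\<close>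

context filtered_group begin

lemma K_Suc_mem: "\<lbrakk>s \<ge> 1; x \<in> K (Suc s)\<rbrakk> \<Longrightarrow> x \<in> K s"
  using K_Suc_subset by blast

lemma K_coset_eq_iff:
  "\<lbrakk>s \<ge> 1; x \<in> carrier G; y \<in> carrier G\<rbrakk> \<Longrightarrow> K s #> x = K s #> y \<longleftrightarrow> x \<otimes> inv y \<in> K s"
  using rcos_eq_iff subgroup_K by blast

lemma K_coset_eq_K_iff:
  "\<lbrakk>s \<ge> 1; x \<in> carrier G\<rbrakk> \<Longrightarrow> K s #> x = K s \<longleftrightarrow> x \<in> K s"
  using coset_join1 coset_join2 subgroup_K subgroup.subset by metis

lemma normal_K_restrict:
  assumes "s \<ge> 1"
  shows "K (Suc s) \<lhd> G\<lparr>carrier := K s\<rparr>"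
  using assms
  by (intro normal_restrict_supergroup subgroup_K normal_K K_Suc_subset) auto

lemma carrier_gr_part: "carrier (gr_part G K s) = (\<lambda>x. K (Suc s) #> x) ` K s"
  by (simp add: gr_part_def carrier_FactGroup)

lemma one_gr_part [simp]: "\<one>\<^bsub>gr_part G K s\<^esub> = K (Suc s)"
  by (simp add: gr_part_def)

lemma mult_gr_part:
  assumes "s \<ge> 1" "x \<in> K s" "y \<in> K s"
  shows "(K (Suc s) #> x) \<otimes>\<^bsub>gr_part G K s\<^esub> (K (Suc s) #> y) = K (Suc s) #> (x \<otimes> y)"
  using assms normal.rcos_sum[OF normal_K[of "Suc s"]] K_carrier by (simp add: gr_part_def)

text \<open>(K s, K s) lies in K (2s), and s \<ge> 1 gives 2s \<ge> s + 1.\<close>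

lemma comm_group_gr_part:
  assumes s: "s \<ge> 1"
  shows "comm_group (gr_part G K s)"
proof -
  interpret N: normal "K (Suc s)" "G\<lparr>carrier := K s\<rparr>" by (rule normal_K_restrict[OF s])
  interpret M: subgroup "K s" G by (rule subgroup_K[OF s])
  show ?thesis
  proof (rule group.group_comm_groupI)
    show "group (gr_part G K s)" unfolding gr_part_def using N.factorgroup_is_group by simp
    fix X Y assume "X \<in> carrier (gr_part G K s)" "Y \<in> carrier (gr_part G K s)"
    then obtain x y where x: "x \<in> K s" "X = K (Suc s) #> x" and y: "y \<in> K s" "Y = K (Suc s) #> y"
      by (auto simp: carrier_gr_part)
    have c: "x \<in> carrier G" "y \<in> carrier G" using x y s K_carrier by blast+
    have "group_commutator G x y \<in> K (s + s)" using group_commutator_K[OF s s x(1) y(1)] .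
    moreover have "K (s + s) \<subseteq> K (Suc s)" using s by (intro K_antimono) auto
    ultimately have "group_commutator G x y \<in> K (Suc s)" by blast
    then show "X \<otimes>\<^bsub>gr_part G K s\<^esub> Y = Y \<otimes>\<^bsub>gr_part G K s\<^esub> X"
      using x y s c K_coset_eq_iff[of "Suc s" "x \<otimes> y" "y \<otimes> x"]
      by (simp add: mult_gr_part group_commutator_def inv_mult_group m_assoc)
  qed
qed

lemma group_gr_part: "s \<ge> 1 \<Longrightarrow> group (gr_part G K s)"
  using comm_group_gr_part comm_group_def by blast

lemma gr_part_nonempty:
  assumes "s \<ge> 1" "X \<in> carrier (gr_part G K s)"
  obtains x where "x \<in> X"
proof -
  obtain x where "x \<in> K s" "X = K (Suc s) #> x" using assms by (auto simp: carrier_gr_part)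
  then have "x \<in> X" using assms(1) rcos_self K_carrier subgroup_K[of "Suc s"] by simp
  then show thesis by (rule that)
qed

text \<open>Classes are sets, so their own members serve as representatives; this fact leads from a
  chosen member back to its class.\<close>

lemma gr_part_mem:
  assumes s: "s \<ge> 1" and X: "X \<in> carrier (gr_part G K s)" and x: "x \<in> X"
  shows "x \<in> K s" "X = K (Suc s) #> x"
proof -
  obtain y where y: "y \<in> K s" "X = K (Suc s) #> y" using X by (auto simp: carrier_gr_part)
  then obtain k where k: "k \<in> K (Suc s)" "x = k \<otimes> y" using x by (auto simp: r_coset_def)
  interpret M: subgroup "K s" G by (rule subgroup_K[OF s])
  show "x \<in> K s" using k y K_Suc_mem[OF s] by simp
  show "X = K (Suc s) #> x"
    using y x s K_carrier[OF s y(1)] subgroup_K[of "Suc s"] repr_independence[of x "K (Suc s)" y] by simp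
qed

lemma carrier_gr:
  "carrier (gr G K) = {X \<in> \<Pi>\<^sub>E s\<in>{1..}. carrier (gr_part G K s). finite {s \<in> {1..}. X s \<noteq> K (Suc s)}}"
proof -
  have "carrier (sum_group {1..} (gr_part G K)) =
      {X \<in> \<Pi>\<^sub>E s\<in>{1..}. carrier (gr_part G K s). finite {s \<in> {1..}. X s \<noteq> \<one>\<^bsub>gr_part G K s\<^esub>}}"
    by (rule carrier_sum_group) (simp add: group_gr_part)
  then show ?thesis by (simp add: gr_def)
qed

lemma gr_component: "\<lbrakk>X \<in> carrier (gr G K); s \<ge> 1\<rbrakk> \<Longrightarrow> X s \<in> carrier (gr_part G K s)"
  by (auto simp: carrier_gr)

lemma gr_component_nonempty:
  assumes "X \<in> carrier (gr G K)" "s \<ge> 1"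
  obtains x where "x \<in> X s"
  using gr_part_nonempty gr_component assms by metis

lemma gr_component_mem:
  assumes "X \<in> carrier (gr G K)" "s \<ge> 1" "x \<in> X s"
  shows "x \<in> K s" "X s = K (Suc s) #> x"
  using gr_part_mem gr_component assms by blast+

lemma gr_eqI:
  assumes "X \<in> carrier (gr G K)" "Y \<in> carrier (gr G K)" "\<And>s. s \<ge> 1 \<Longrightarrow> X s = Y s"
  shows "X = Y"
  using assms by (intro PiE_ext[of X "{1..}" "\<lambda>s. carrier (gr_part G K s)" Y]) (auto simp: carrier_gr)

lemma one_gr: "\<one>\<^bsub>gr G K\<^esub> = (\<lambda>s \<in> {1..}. K (Suc s))"
  by (simp add: gr_def)

lemma mult_gr_apply:
  "s \<ge> 1 \<Longrightarrow> (X \<otimes>\<^bsub>gr G K\<^esub> Y) s = X s \<otimes>\<^bsub>gr_part G K s\<^esub> Y s"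
  by (simp add: gr_def)

text \<open>\<open>gr\<close> copies carrier, product and unit of the direct sum, and the group
  axioms see only these fields.\<close>

lemma group_gr: "group (gr G K)"
proof -
  have "group (sum_group {1..} (gr_part G K))" by (rule sum_group) (simp add: group_gr_part)
  then show ?thesis
    by (simp add: group_def monoid_def group_axioms_def Units_def gr_def)
qed

text \<open>The inclusion of the summand of degree \<open>s\<close>, on representatives;
  \<open>K (Suc t)\<close> is the unit of the quotient in degree \<open>t\<close>.\<close>

definition gr_single :: "nat \<Rightarrow> 'a \<Rightarrow> nat \<Rightarrow> 'a set" where
  "gr_single s x = (\<lambda>t \<in> {1..}. if t = s then K (Suc s) #> x else K (Suc t))"

lemma K_in_carrier_gr_part: "s \<ge> 1 \<Longrightarrow> K (Suc s) \<in> carrier (gr_part G K s)"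
  using group.is_monoid[OF group_gr_part] monoid.one_closed one_gr_part by metis

lemma gr_single_closed:
  assumes "s \<ge> 1" "x \<in> K s"
  shows "gr_single s x \<in> carrier (gr G K)"
proof -
  have "finite {t \<in> {1..}. gr_single s x t \<noteq> K (Suc t)}"
    by (rule finite_subset[of _ "{s}"]) (auto simp: gr_single_def)
  moreover have "gr_single s x \<in> (\<Pi>\<^sub>E s\<in>{1..}. carrier (gr_part G K s))"
    using assms K_in_carrier_gr_part by (auto simp: gr_single_def carrier_gr_part[of s])
  ultimately show ?thesis by (simp add: carrier_gr)
qed

lemma gr_single_same: "s \<ge> 1 \<Longrightarrow> gr_single s x s = K (Suc s) #> x"
  and gr_single_other: "t \<ge> 1 \<Longrightarrow> t \<noteq> s \<Longrightarrow> gr_single s x t = K (Suc t)"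
  by (simp_all add: gr_single_def)

lemma homog_gr:
  "homog (gr G K) s = {X \<in> carrier (gr G K). \<forall>t \<ge> 1. t \<noteq> s \<longrightarrow> X t = K (Suc t)}"
  by (auto simp: gr_def)

lemma gr_single_homog: "\<lbrakk>s \<ge> 1; x \<in> K s\<rbrakk> \<Longrightarrow> gr_single s x \<in> homog (gr G K) s"
  by (simp add: homog_gr gr_single_closed gr_single_other)

lemma gr_single_eq_one_iff:
  assumes "s \<ge> 1" "x \<in> K s"
  shows "gr_single s x = \<one>\<^bsub>gr G K\<^esub> \<longleftrightarrow> x \<in> K (Suc s)"
proof
  assume "gr_single s x = \<one>\<^bsub>gr G K\<^esub>"
  then have "gr_single s x s = \<one>\<^bsub>gr G K\<^esub> s" by simp
  then show "x \<in> K (Suc s)"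
    using assms K_carrier K_coset_eq_K_iff[of "Suc s" x] by (simp add: gr_single_same one_gr)
next
  assume "x \<in> K (Suc s)"
  then have "K (Suc s) #> x = K (Suc s)"
    using assms K_carrier[of s x] K_coset_eq_K_iff[of "Suc s" x] by simp
  then show "gr_single s x = \<one>\<^bsub>gr G K\<^esub>"
    by (auto simp: one_gr gr_single_def fun_eq_iff)
qed

end

section \<open>Maps induced on graded groups\<close>

lemma the_elem_image_const:
  assumes "A \<noteq> {}" "\<And>x. x \<in> A \<Longrightarrow> f x = c"
  shows "the_elem (f ` A) = c"
proof -
  have "f ` A = {c}" using assms by force
  then show ?thesis by simp
qed

locale filtered_hom = G: filtered_group G K + H: filtered_group H L + group_hom G H h
  for G (structure) and K and H (structure) and L and h +
  assumes h_K: "s \<ge> 1 \<Longrightarrow> x \<in> K s \<Longrightarrow> h x \<in> L s"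
begin

text \<open>Two members of X s differ by an element of K (s + 1), whose image lies in L (s + 1); so
  the set under \<open>the_elem\<close> is a singleton.\<close>

lemma gr_map_component:
  assumes X: "X \<in> carrier (gr G K)" and s: "s \<ge> 1" and x: "x \<in> X s"
  shows "gr_map G K H L h X s = L (Suc s) #>\<^bsub>H\<^esub> h x"
proof -
  have "the_elem ((\<lambda>x. L (Suc s) #>\<^bsub>H\<^esub> h x) ` X s) = L (Suc s) #>\<^bsub>H\<^esub> h x"
  proof (rule the_elem_image_const)
    fix y assume y: "y \<in> X s"
    note mx = G.gr_component_mem[OF X s x] and my = G.gr_component_mem[OF X s y]
    have c: "x \<in> carrier G" "y \<in> carrier G" using mx my s G.K_carrier by blast+
    then have "y \<otimes>\<^bsub>G\<^esub> inv\<^bsub>G\<^esub> x \<in> K (Suc s)"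
      using mx(2) my(2) G.K_coset_eq_iff[of "Suc s" y x] by simp
    then have "h (y \<otimes>\<^bsub>G\<^esub> inv\<^bsub>G\<^esub> x) \<in> L (Suc s)" by (intro h_K) auto
    then show "L (Suc s) #>\<^bsub>H\<^esub> h y = L (Suc s) #>\<^bsub>H\<^esub> h x"
      using c H.K_coset_eq_iff[of "Suc s" "h y" "h x"] by simp
  qed (use x in blast)
  then show ?thesis using X s by (simp add: gr_map_def)
qed

lemma gr_map_trivial_component:
  assumes X: "X \<in> carrier (gr G K)" and s: "s \<ge> 1" and "X s = K (Suc s)"
  shows "gr_map G K H L h X s = L (Suc s)"
proof -
  have "\<one>\<^bsub>G\<^esub> \<in> X s" using assms(3) G.subgroup_K[of "Suc s"] by (simp add: subgroup.one_closed)
  then show ?thesis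
    using gr_map_component[OF X s] H.K_coset_eq_K_iff[of "Suc s" "\<one>\<^bsub>H\<^esub>"] H.subgroup_K[of "Suc s"]
    by (simp add: subgroup.one_closed)
qed

lemma gr_map_closed:
  assumes X: "X \<in> carrier (gr G K)"
  shows "gr_map G K H L h X \<in> carrier (gr H L)"
proof -
  have "gr_map G K H L h X s \<in> carrier (gr_part H L s)" if s: "s \<ge> 1" for s
  proof -
    obtain x where x: "x \<in> X s" using G.gr_component_nonempty[OF X s] .
    have "h x \<in> L s" using G.gr_component_mem[OF X s x] s h_K by blast
    then show ?thesis by (simp add: gr_map_component[OF X s x] H.carrier_gr_part)
  qed
  moreover have "gr_map G K H L h X \<in> extensional {1..}" using X by (simp add: gr_map_def)
  moreover have "{s \<in> {1..}. gr_map G K H L h X s \<noteq> L (Suc s)} \<subseteq> {s \<in> {1..}. X s \<noteq> K (Suc s)}"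
    using gr_map_trivial_component[OF X] by auto
  then have "finite {s \<in> {1..}. gr_map G K H L h X s \<noteq> L (Suc s)}"
    by (rule finite_subset) (use X in \<open>simp add: G.carrier_gr\<close>)
  ultimately show ?thesis by (auto simp: H.carrier_gr PiE_def)
qed

lemma gr_map_homog:
  assumes "X \<in> homog (gr G K) s"
  shows "gr_map G K H L h X \<in> homog (gr H L) s"
  using assms by (simp add: G.homog_gr H.homog_gr gr_map_closed gr_map_trivial_component)

lemma gr_map_single:
  assumes "s \<ge> 1" "x \<in> K s"
  shows "gr_map G K H L h (G.gr_single s x) = H.gr_single s (h x)"
proof (rule H.gr_eqI)
  note c = G.gr_single_closed[OF assms]
  show "gr_map G K H L h (G.gr_single s x) \<in> carrier (gr H L)" by (rule gr_map_closed[OF c])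
  show "H.gr_single s (h x) \<in> carrier (gr H L)" by (intro H.gr_single_closed h_K assms)
  fix t :: nat assume t: "t \<ge> 1"
  show "gr_map G K H L h (G.gr_single s x) t = H.gr_single s (h x) t"
  proof (cases "t = s")
    case True
    have "x \<in> G.gr_single s x s"
      using assms G.rcos_self[of x "K (Suc s)"] G.K_carrier G.subgroup_K[of "Suc s"]
      by (simp add: G.gr_single_same)
    then show ?thesis
      using gr_map_component[OF c assms(1)] assms True by (simp add: H.gr_single_same)
  next
    case False
    then show ?thesis
      using gr_map_trivial_component[OF c t] t by (simp add: G.gr_single_other H.gr_single_other)
  qed
qed

lemma gr_map_mult:
  assumes X: "X \<in> carrier (gr G K)" and Y: "Y \<in> carrier (gr G K)"
  shows "gr_map G K H L h (X \<otimes>\<^bsub>gr G K\<^esub> Y) = gr_map G K H L h X \<otimes>\<^bsub>gr H L\<^esub> gr_map G K H L h Y"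
proof (rule H.gr_eqI)
  interpret A: group "gr G K" by (rule G.group_gr)
  interpret B: group "gr H L" by (rule H.group_gr)
  have XY: "X \<otimes>\<^bsub>gr G K\<^esub> Y \<in> carrier (gr G K)" using X Y by simp
  show "gr_map G K H L h (X \<otimes>\<^bsub>gr G K\<^esub> Y) \<in> carrier (gr H L)" by (rule gr_map_closed[OF XY])
  show "gr_map G K H L h X \<otimes>\<^bsub>gr H L\<^esub> gr_map G K H L h Y \<in> carrier (gr H L)"
    using X Y gr_map_closed by simp
  fix s :: nat assume s: "s \<ge> 1"
  obtain x y where x: "x \<in> X s" and y: "y \<in> Y s"
    using G.gr_component_nonempty[OF X s] G.gr_component_nonempty[OF Y s] by metis
  note mx = G.gr_component_mem[OF X s x] and my = G.gr_component_mem[OF Y s y]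
  have c: "x \<in> carrier G" "y \<in> carrier G" using mx my s G.K_carrier by blast+
  have "(X \<otimes>\<^bsub>gr G K\<^esub> Y) s = K (Suc s) #> (x \<otimes> y)"
    using s mx my by (simp add: G.mult_gr_apply G.mult_gr_part)
  then have "x \<otimes> y \<in> (X \<otimes>\<^bsub>gr G K\<^esub> Y) s"
    using c G.rcos_self[of "x \<otimes> y" "K (Suc s)"] G.subgroup_K[of "Suc s"] by simp
  then have "gr_map G K H L h (X \<otimes>\<^bsub>gr G K\<^esub> Y) s = L (Suc s) #>\<^bsub>H\<^esub> h (x \<otimes> y)"
    by (rule gr_map_component[OF XY s])
  also have "\<dots> = (gr_map G K H L h X \<otimes>\<^bsub>gr H L\<^esub> gr_map G K H L h Y) s"
    using s c mx(1) my(1) h_K H.mult_gr_part[of s "h x" "h y"]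
    by (simp add: H.mult_gr_apply gr_map_component[OF X s x] gr_map_component[OF Y s y])
  finally show "gr_map G K H L h (X \<otimes>\<^bsub>gr G K\<^esub> Y) s
      = (gr_map G K H L h X \<otimes>\<^bsub>gr H L\<^esub> gr_map G K H L h Y) s" .
qed

lemma group_hom_gr_map: "group_hom (gr G K) (gr H L) (gr_map G K H L h)"
  by (simp add: group_hom_def group_hom_axioms_def hom_def G.group_gr H.group_gr gr_map_closed gr_map_mult)

text \<open>The induced map is a homomorphism, so injectivity in degree s is a matter of its kernel,
  and the class of x dies exactly when h x falls into the next term of L. The map \<phi> is left an
  arbitrary function, so that both Johnson homomorphisms can take its place.\<close>

lemma gr_map_inj_on_homog_iff:
  assumes "s \<ge> 1" and inj: "inj_on \<phi> (homog (gr H L) s)"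
  shows "inj_on (\<phi> \<circ> gr_map G K H L h) (homog (gr G K) s)
    \<longleftrightarrow> (\<forall>x \<in> K s. h x \<in> L (Suc s) \<longrightarrow> x \<in> K (Suc s))"
proof
  interpret A: group_hom "gr G K" "gr H L" "gr_map G K H L h" by (rule group_hom_gr_map)
  assume *: "inj_on (\<phi> \<circ> gr_map G K H L h) (homog (gr G K) s)"
  show "\<forall>x \<in> K s. h x \<in> L (Suc s) \<longrightarrow> x \<in> K (Suc s)"
  proof (intro ballI impI)
    fix x assume x: "x \<in> K s" "h x \<in> L (Suc s)"
    have "gr_map G K H L h (G.gr_single s x) = gr_map G K H L h \<one>\<^bsub>gr G K\<^esub>"
      using x assms(1) by (simp add: gr_map_single H.gr_single_eq_one_iff h_K)
    moreover have "\<one>\<^bsub>gr G K\<^esub> \<in> homog (gr G K) s"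
      using monoid.one_closed[OF group.is_monoid[OF G.group_gr]] by (simp add: G.homog_gr G.one_gr)
    ultimately have "G.gr_single s x = \<one>\<^bsub>gr G K\<^esub>"
      using inj_onD[OF *, of "G.gr_single s x" "\<one>\<^bsub>gr G K\<^esub>"] G.gr_single_homog[OF assms(1) x(1)]
      by simp
    then show "x \<in> K (Suc s)" using x assms(1) by (simp add: G.gr_single_eq_one_iff)
  qed
next
  assume *: "\<forall>x \<in> K s. h x \<in> L (Suc s) \<longrightarrow> x \<in> K (Suc s)"
  have "inj_on (gr_map G K H L h) (homog (gr G K) s)"
  proof (rule inj_onI)
    fix X Y assume X: "X \<in> homog (gr G K) s" and Y: "Y \<in> homog (gr G K) s"
      and eq: "gr_map G K H L h X = gr_map G K H L h Y"
    then have Xc: "X \<in> carrier (gr G K)" and Yc: "Y \<in> carrier (gr G K)"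
      by (simp_all add: G.homog_gr)
    obtain x y where x: "x \<in> X s" and y: "y \<in> Y s"
      using G.gr_component_nonempty[OF Xc assms(1)] G.gr_component_nonempty[OF Yc assms(1)] by metis
    note mx = G.gr_component_mem[OF Xc assms(1) x] and my = G.gr_component_mem[OF Yc assms(1) y]
    have c: "x \<in> carrier G" "y \<in> carrier G" using mx my assms(1) G.K_carrier by blast+
    have "L (Suc s) #>\<^bsub>H\<^esub> h x = L (Suc s) #>\<^bsub>H\<^esub> h y"
      using eq gr_map_component[OF Xc assms(1) x] gr_map_component[OF Yc assms(1) y] by simp
    then have "h (x \<otimes> inv\<^bsub>G\<^esub> y) \<in> L (Suc s)"
      using c H.K_coset_eq_iff[of "Suc s" "h x" "h y"] by simp
    moreover have "x \<otimes> inv\<^bsub>G\<^esub> y \<in> K s"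
      using mx my G.subgroup_K[OF assms(1)] by (simp add: subgroup.m_closed subgroup.m_inv_closed)
    ultimately have "x \<otimes> inv\<^bsub>G\<^esub> y \<in> K (Suc s)" using * by blast
    then have "X s = Y s" using mx my c G.K_coset_eq_iff[of "Suc s" x y] by simp
    then show "X = Y"
      using X Y by (intro G.gr_eqI[OF Xc Yc]) (metis (mono_tags, lifting) G.homog_gr mem_Collect_eq)
  qed
  moreover have "inj_on \<phi> (gr_map G K H L h ` homog (gr G K) s)"
    using inj gr_map_homog by (auto intro: inj_on_subset)
  ultimately show "inj_on (\<phi> \<circ> gr_map G K H L h) (homog (gr G K) s)" by (rule comp_inj_on)
qed

end

lemma (in filtered_hom) gr_map_surj:
  assumes onto: "\<And>s. s \<ge> 1 \<Longrightarrow> h ` K s = L s"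
  shows "gr_map G K H L h ` carrier (gr G K) = carrier (gr H L)"
proof (intro equalityI subsetI)
  fix U assume U: "U \<in> carrier (gr H L)"
  have "\<exists>x \<in> K s. h x \<in> U s" if s: "s \<ge> 1" for s
  proof -
    obtain u where u: "u \<in> U s" using H.gr_component_nonempty[OF U s] .
    then have "u \<in> h ` K s" using H.gr_component_mem[OF U s] onto[OF s] by simp
    then show ?thesis using u by blast
  qed
  then obtain c where c: "c s \<in> K s" "h (c s) \<in> U s" if "s \<ge> 1" for s by metis
  \<comment> \<open>A lift \<open>c s\<close> of a trivial class may itself represent a nontrivial
    one. Where U is trivial the unit is taken instead, which keeps the support of X finite.\<close>
  define X where "X = (\<lambda>s \<in> {1..}. if U s = L (Suc s) then K (Suc s) else K (Suc s) #> c s)"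
  have X: "X \<in> carrier (gr G K)"
  proof -
    have "X s \<in> carrier (gr_part G K s)" if "s \<ge> 1" for s
      using that c G.K_in_carrier_gr_part[OF that] by (simp add: X_def G.carrier_gr_part)
    moreover have "finite {s \<in> {1..}. X s \<noteq> K (Suc s)}"
      by (rule finite_subset[of _ "{s \<in> {1..}. U s \<noteq> L (Suc s)}"])
        (use U in \<open>auto simp: X_def H.carrier_gr\<close>)
    moreover have "X \<in> extensional {1..}" by (simp add: X_def)
    ultimately show ?thesis by (auto simp: G.carrier_gr PiE_def)
  qed
  have "gr_map G K H L h X = U"
  proof (rule H.gr_eqI[OF gr_map_closed[OF X] U])
    fix s :: nat assume s: "s \<ge> 1"
    show "gr_map G K H L h X s = U s"
    proof (cases "U s = L (Suc s)")
      case True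
      then show ?thesis using gr_map_trivial_component[OF X s] s by (simp add: X_def)
    next
      case False
      then have "c s \<in> X s"
        using s c(1)[OF s] G.rcos_self[of "c s" "K (Suc s)"] G.K_carrier G.subgroup_K[of "Suc s"]
        by (simp add: X_def)
      then show ?thesis
        using gr_map_component[OF X s] H.gr_component_mem(2)[OF U s c(2)[OF s]] by simp
    qed
  qed
  then show "U \<in> gr_map G K H L h ` carrier (gr G K)" using X by blast
qed (use gr_map_closed in blast)

text \<open>The maps \<open>iota\<close> and \<open>outer_iota\<close> are the graded maps of this
  homomorphism, for the two Torelli groups.\<close>

lemma (in filtered_group) filtered_hom_lower_central:
  "filtered_hom G (lower_central G) G K id"
proof -
  interpret \<Gamma>: filtered_group G "lower_central G" by (rule filtered_group_lower_central)
  show ?thesis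
    using lower_central_subset_K
    by (intro filtered_hom.intro filtered_hom_axioms.intro)
      (auto simp: \<Gamma>.filtered_group_axioms filtered_group_axioms group_hom_def group_hom_axioms_def is_group hom_def)
qed

text \<open>If the filtrations agree at s, then K (s + 1) lies in K s = \<Gamma>^s, where the
  inclusion for s applies. Each of the q inclusions thus carries the equality one degree up, which
  is why the right side reaches q + 1.\<close>

lemma (in filtered_group) lower_central_eq_iff:
  "(\<forall>s \<in> {1..q}. \<forall>x \<in> lower_central G s. x \<in> K (Suc s) \<longrightarrow> x \<in> lower_central G (Suc s))
    \<longleftrightarrow> (\<forall>s \<in> {1..q + 1}. lower_central G s = K s)"
proof
  assume *: "\<forall>s \<in> {1..q}. \<forall>x \<in> lower_central G s. x \<in> K (Suc s) \<longrightarrow> x \<in> lower_central G (Suc s)"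
  have "lower_central G s = K s" if "1 \<le> s" "s \<le> q + 1" for s
    using that
  proof (induction s rule: dec_induct)
    case base
    then show ?case using K_1 by simp
  next
    case (step s)
    then have "lower_central G s = K s" "s \<in> {1..q}" by auto
    then have "K (Suc s) \<subseteq> lower_central G (Suc s)" using * K_Suc_mem[OF step.hyps(1)] by auto
    then show ?case using lower_central_subset_K[of "Suc s"] by auto
  qed
  then show "\<forall>s \<in> {1..q + 1}. lower_central G s = K s" by simp
qed auto

section \<open>The Johnson homomorphism\<close>

context group begin

interpretation \<Gamma>: filtered_group G "lower_central G" by (rule filtered_group_lower_central)
interpretation F: filtered_group "torelli G" "johnson_filtration G" by (rule filtered_group_johnson)
interpretation A: group "AutoGroup G" by (rule AutoGroup)

lemma mult_torelli [simp]: "mult (torelli G) = mult (AutoGroup G)"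
  and one_torelli [simp]: "\<one>\<^bsub>torelli G\<^esub> = \<one>\<^bsub>AutoGroup G\<^esub>"
  and carrier_torelli: "carrier (torelli G) = johnson_filtration G 1"
  by (simp_all add: torelli_def)

lemma inv_torelli:
  "\<alpha> \<in> johnson_filtration G 1 \<Longrightarrow> inv\<^bsub>torelli G\<^esub> \<alpha> = inv\<^bsub>AutoGroup G\<^esub> \<alpha>"
  unfolding torelli_def by (rule A.m_inv_consistent[OF subgroup_johnson_filtration])

lemma r_coset_torelli [simp]: "N #>\<^bsub>torelli G\<^esub> \<alpha> = N #>\<^bsub>AutoGroup G\<^esub> \<alpha>"
  by (simp add: r_coset_def)

lemma johnson_filtration_closed:
  "\<lbrakk>\<alpha> \<in> johnson_filtration G s; x \<in> carrier G\<rbrakk> \<Longrightarrow> \<alpha> x \<in> carrier G"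
  using AutoGroup_closed[OF johnson_filtration_AutoGroup] .

lemma lower_central_coset_eqI:
  assumes "\<alpha> \<in> johnson_filtration G s" "t \<ge> 1" "x \<in> lower_central G t" "1 \<le> n" "n \<le> s + t"
  shows "lower_central G n #> \<alpha> x = lower_central G n #> x"
proof -
  have x: "x \<in> carrier G" using assms \<Gamma>.K_carrier by blast
  have "\<alpha> x \<otimes> inv x \<in> lower_central G n"
    using johnson_filtration_shift[OF assms(2,1,3)] \<Gamma>.K_antimono[OF assms(4,5)] by blast
  then show ?thesis
    using \<Gamma>.K_coset_eq_iff[OF assms(4) johnson_filtration_closed[OF assms(1) x] x] by simp
qed

text \<open>The crossed homomorphism rule: with a and b the displacements of x under \<alpha> and
  \<beta>, the left displacement equals \<alpha>(b) a exactly, and \<alpha> moves b, an element of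
  \<Gamma>^(j+t), only by \<Gamma>^(i+j+t). The degrees i and j are kept apart because
  well-definedness of J uses (s+1, s) and additivity uses (s, s).\<close>

lemma displacement_mult_AutoGroup:
  assumes \<alpha>: "\<alpha> \<in> johnson_filtration G i" and \<beta>: "\<beta> \<in> johnson_filtration G j"
    and t: "t \<ge> 1" "x \<in> lower_central G t" and n: "1 \<le> n" "n \<le> i + j + t"
  shows "lower_central G n #> ((\<alpha> \<otimes>\<^bsub>AutoGroup G\<^esub> \<beta>) x \<otimes> inv x)
    = lower_central G n #> ((\<beta> x \<otimes> inv x) \<otimes> (\<alpha> x \<otimes> inv x))"
proof -
  interpret N: normal "lower_central G n" G by (rule normal_lower_central[OF n(1)])
  have x: "x \<in> carrier G" using t \<Gamma>.K_carrier by blast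
  have aA: "\<alpha> \<in> carrier (AutoGroup G)" "\<beta> \<in> carrier (AutoGroup G)"
    using \<alpha> \<beta> johnson_filtration_AutoGroup by blast+
  define b where "b = \<beta> x \<otimes> inv x"
  define a where "a = \<alpha> x \<otimes> inv x"
  have ax: "\<alpha> x \<in> carrier G" and bx: "\<beta> x \<in> carrier G"
    using \<alpha> \<beta> x johnson_filtration_closed by blast+
  have c: "a \<in> carrier G" "b \<in> carrier G" using ax bx x by (simp_all add: a_def b_def)
  have ab: "\<alpha> b \<in> carrier G" using \<alpha> c johnson_filtration_closed by blast
  have "\<beta> x = b \<otimes> x" using bx x by (simp add: b_def m_assoc)
  then have "(\<alpha> \<otimes>\<^bsub>AutoGroup G\<^esub> \<beta>) x = \<alpha> b \<otimes> \<alpha> x"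
    using mult_AutoGroup_apply[OF aA x] hom_mult[OF AutoGroup_hom[OF aA(1)] c(2) x] by simp
  then have "(\<alpha> \<otimes>\<^bsub>AutoGroup G\<^esub> \<beta>) x \<otimes> inv x = \<alpha> b \<otimes> a"
    using ab ax x by (simp add: a_def m_assoc)
  moreover have "lower_central G n #> \<alpha> b = lower_central G n #> b"
    using johnson_filtration_shift[OF t(1) \<beta> t(2)] t(1) n
    by (intro lower_central_coset_eqI[OF \<alpha>, of "j + t"]) (auto simp: b_def)
  ultimately have "lower_central G n #> ((\<alpha> \<otimes>\<^bsub>AutoGroup G\<^esub> \<beta>) x \<otimes> inv x) = lower_central G n #> (b \<otimes> a)"
    using N.rcos_sum[OF ab c(1)] N.rcos_sum[OF c(2,1)] by simp
  then show ?thesis by (simp only: a_def b_def)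
qed

text \<open>The left displacement is \<alpha>(k) a k^-1 with a that of x. Modulo \<Gamma>^(s+u) one
  may replace \<alpha>(k) by k, and then k cancels because (k, a) lies in \<Gamma>^(s+t+u).
  Well-definedness of J takes u = t + 1.\<close>

lemma displacement_mult:
  assumes \<alpha>: "\<alpha> \<in> johnson_filtration G s" and t: "t \<ge> 1" "x \<in> lower_central G t"
    and u: "u \<ge> 1" "k \<in> lower_central G u"
    and n: "1 \<le> n" "n \<le> s + t + u" "n \<le> s + u"
  shows "lower_central G n #> (\<alpha> (k \<otimes> x) \<otimes> inv (k \<otimes> x)) = lower_central G n #> (\<alpha> x \<otimes> inv x)"
proof -
  interpret N: normal "lower_central G n" G by (rule normal_lower_central[OF n(1)])
  have x: "x \<in> carrier G" and k: "k \<in> carrier G" using t u \<Gamma>.K_carrier by blast+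
  have ax: "\<alpha> x \<in> carrier G" and ak: "\<alpha> k \<in> carrier G"
    using \<alpha> x k johnson_filtration_closed by blast+
  define a where "a = \<alpha> x \<otimes> inv x"
  have a: "a \<in> carrier G" using ax x by (simp add: a_def)
  have "\<alpha> (k \<otimes> x) = \<alpha> k \<otimes> \<alpha> x"
    using hom_mult[OF AutoGroup_hom[OF johnson_filtration_AutoGroup[OF \<alpha>]] k x] .
  then have eq: "\<alpha> (k \<otimes> x) \<otimes> inv (k \<otimes> x) = \<alpha> k \<otimes> (a \<otimes> inv k)"
    using ak ax x k by (simp add: a_def m_assoc inv_mult_group)
  have ak': "lower_central G n #> \<alpha> k = lower_central G n #> k"
    by (rule lower_central_coset_eqI[OF \<alpha> u n(1,3)])
  have "a \<in> lower_central G (s + t)" using johnson_filtration_shift[OF t(1) \<alpha> t(2)] by (simp add: a_def)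
  then have "group_commutator G k a \<in> lower_central G (u + (s + t))"
    using t(1) by (intro \<Gamma>.group_commutator_K u) auto
  then have "group_commutator G k a \<in> lower_central G n"
    using \<Gamma>.K_antimono[of n "u + (s + t)"] n by auto
  then have "lower_central G n #> (k \<otimes> (a \<otimes> inv k)) = lower_central G n #> a"
    using k a by (simp add: \<Gamma>.K_coset_eq_iff[OF n(1)] group_commutator_def m_assoc)
  then have "lower_central G n #> (\<alpha> k \<otimes> (a \<otimes> inv k)) = lower_central G n #> a"
    using N.rcos_sum[of "\<alpha> k" "a \<otimes> inv k"] N.rcos_sum[of k "a \<otimes> inv k"] ak' ak a k by simp
  then show ?thesis by (simp only: eq a_def)
qed

text \<open>Independence of both representatives. Changing x by \<Gamma>^(t+1) is harmless by
  \<open>displacement_mult\<close>; changing \<alpha> by \<phi> in F^(s+1) multiplies the value by a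
  displacement under \<phi>, which lies in \<Gamma>^(s+t+1).\<close>

lemma johnson_part_eq:
  assumes s: "s \<ge> 1" and t: "t \<ge> 1"
    and A: "A \<in> carrier (gr_part (torelli G) (johnson_filtration G) s)" and \<alpha>: "\<alpha> \<in> A"
    and X: "X \<in> carrier (gr_part G (lower_central G) t)" and x: "x \<in> X"
  shows "johnson_part G s t A X = lower_central G (Suc (s + t)) #> (\<alpha> x \<otimes> inv x)"
proof -
  let ?N = "lower_central G (Suc (s + t))"
  note mx = \<Gamma>.gr_part_mem[OF t X] and ma = F.gr_part_mem[OF s A]
  have const: "?N #> (\<beta> y \<otimes> inv y) = ?N #> (\<alpha> x \<otimes> inv x)" if \<beta>: "\<beta> \<in> A" and y: "y \<in> X" for \<beta> y
  proof -
    have "y \<in> lower_central G (Suc t) #> x" using mx(2)[OF x] y by simp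
    then obtain k where k: "k \<in> lower_central G (Suc t)" "y = k \<otimes> x" by (auto simp: r_coset_def)
    have "\<beta> \<in> johnson_filtration G (Suc s) #>\<^bsub>torelli G\<^esub> \<alpha>" using ma(2)[OF \<alpha>] \<beta> by simp
    then obtain \<phi> where \<phi>: "\<phi> \<in> johnson_filtration G (Suc s)" "\<beta> = \<phi> \<otimes>\<^bsub>AutoGroup G\<^esub> \<alpha>"
      by (auto simp: r_coset_def)
    have c: "x \<in> carrier G" "\<alpha> x \<in> carrier G" "\<phi> x \<in> carrier G"
      using mx(1)[OF x] t \<Gamma>.K_carrier johnson_filtration_closed[OF ma(1)[OF \<alpha>]]
        johnson_filtration_closed[OF \<phi>(1)] by blast+
    have "?N #> (\<beta> y \<otimes> inv y) = ?N #> (\<beta> x \<otimes> inv x)"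
      unfolding k(2)
      by (rule displacement_mult[OF ma(1)[OF \<beta>] t mx(1)[OF x] _ k(1)]) auto
    also have "\<dots> = ?N #> ((\<alpha> x \<otimes> inv x) \<otimes> (\<phi> x \<otimes> inv x))"
      unfolding \<phi>(2)
      by (rule displacement_mult_AutoGroup[OF \<phi>(1) ma(1)[OF \<alpha>] t mx(1)[OF x]]) auto
    \<comment> \<open>The surplus factor stands on the right, while the cosets absorb on the left;
      normality of \<open>?N\<close> carries it across.\<close>
    also have "\<dots> = ?N #> (\<alpha> x \<otimes> inv x)"
    proof -
      have "\<phi> x \<otimes> inv x \<in> ?N" using johnson_filtration_shift[OF t \<phi>(1) mx(1)[OF x]] by simp
      moreover have "?N \<lhd> G" by (rule normal_lower_central_Suc)
      ultimately have "(\<alpha> x \<otimes> inv x) \<otimes> (\<phi> x \<otimes> inv x) \<otimes> inv (\<alpha> x \<otimes> inv x) \<in> ?N"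
        using c by (intro normal.inv_op_closed2) auto
      then show ?thesis using c by (subst \<Gamma>.K_coset_eq_iff) auto
    qed
    finally show ?thesis .
  qed
  show ?thesis
    unfolding johnson_part_def
  proof (rule the_elem_image_const)
    show "A \<times> X \<noteq> {}" using \<alpha> x by blast
    fix p assume "p \<in> A \<times> X"
    then have "fst p \<in> A" "snd p \<in> X" by auto
    from const[OF this] show "(case p of (\<beta>, y) \<Rightarrow> lower_central G (s + t + 1) #> (\<beta> y \<otimes> inv y))
        = lower_central G (Suc (s + t)) #> (\<alpha> x \<otimes> inv x)"
      by (simp add: case_prod_unfold)
  qed
qed

lemma johnson_part_closed:
  assumes s: "s \<ge> 1" and t: "t \<ge> 1"
    and A: "A \<in> carrier (gr_part (torelli G) (johnson_filtration G) s)"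
    and X: "X \<in> carrier (gr_part G (lower_central G) t)"
  shows "johnson_part G s t A X \<in> carrier (gr_part G (lower_central G) (s + t))"
proof -
  obtain \<alpha> x where ax: "\<alpha> \<in> A" "x \<in> X"
    using F.gr_part_nonempty[OF s A] \<Gamma>.gr_part_nonempty[OF t X] by metis
  then have "\<alpha> x \<otimes> inv x \<in> lower_central G (s + t)"
    using johnson_filtration_shift[OF t] F.gr_part_mem[OF s A] \<Gamma>.gr_part_mem[OF t X] by blast
  then show ?thesis
    by (auto simp: johnson_part_eq[OF s t A ax(1) X ax(2)] \<Gamma>.carrier_gr_part)
qed

lemma johnson_part_mult:
  assumes s: "s \<ge> 1" and t: "t \<ge> 1"
    and A: "A \<in> carrier (gr_part (torelli G) (johnson_filtration G) s)"
    and B: "B \<in> carrier (gr_part (torelli G) (johnson_filtration G) s)"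
    and X: "X \<in> carrier (gr_part G (lower_central G) t)"
  shows "johnson_part G s t (A \<otimes>\<^bsub>gr_part (torelli G) (johnson_filtration G) s\<^esub> B) X
    = johnson_part G s t A X \<otimes>\<^bsub>gr_part G (lower_central G) (s + t)\<^esub> johnson_part G s t B X"
proof -
  interpret P: comm_group "gr_part G (lower_central G) (s + t)"
    using s by (intro \<Gamma>.comm_group_gr_part) auto
  interpret Q: comm_group "gr_part (torelli G) (johnson_filtration G) s"
    by (rule F.comm_group_gr_part[OF s])
  obtain \<alpha> \<beta> x where ax: "\<alpha> \<in> A" "\<beta> \<in> B" "x \<in> X"
    using F.gr_part_nonempty[OF s A] F.gr_part_nonempty[OF s B] \<Gamma>.gr_part_nonempty[OF t X] by metis
  note ma = F.gr_part_mem[OF s A ax(1)] and mb = F.gr_part_mem[OF s B ax(2)]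
    and mx = \<Gamma>.gr_part_mem[OF t X ax(3)]
  have "A \<otimes>\<^bsub>gr_part (torelli G) (johnson_filtration G) s\<^esub> B
      = johnson_filtration G (Suc s) #>\<^bsub>torelli G\<^esub> (\<alpha> \<otimes>\<^bsub>torelli G\<^esub> \<beta>)"
    using F.mult_gr_part[OF s ma(1) mb(1)] ma(2) mb(2) by metis
  moreover have "\<alpha> \<otimes>\<^bsub>torelli G\<^esub> \<beta> \<in> carrier (torelli G)"
    using F.K_carrier[OF s ma(1)] F.K_carrier[OF s mb(1)] by (rule F.m_closed)
  ultimately have ab: "\<alpha> \<otimes>\<^bsub>torelli G\<^esub> \<beta> \<in> A \<otimes>\<^bsub>gr_part (torelli G) (johnson_filtration G) s\<^esub> B"
    using F.rcos_self F.subgroup_K[of "Suc s"] by simp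
  have "johnson_part G s t (A \<otimes>\<^bsub>gr_part (torelli G) (johnson_filtration G) s\<^esub> B) X
      = lower_central G (Suc (s + t)) #> ((\<alpha> \<otimes>\<^bsub>AutoGroup G\<^esub> \<beta>) x \<otimes> inv x)"
    using johnson_part_eq[OF s t Q.m_closed[OF A B] ab X ax(3)] by simp
  \<comment> \<open>The displacement rule reverses the order of the factors, and commutativity of
    the graded part restores it below. The rule reaches this level because s \<ge> 1 gives s + t + 1
    \<le> s + s + t.\<close>
  also have "\<dots> = lower_central G (Suc (s + t)) #> ((\<beta> x \<otimes> inv x) \<otimes> (\<alpha> x \<otimes> inv x))"
    using s by (intro displacement_mult_AutoGroup[OF ma(1) mb(1) t mx(1)]) auto
  also have "\<dots> = johnson_part G s t B X \<otimes>\<^bsub>gr_part G (lower_central G) (s + t)\<^esub> johnson_part G s t A X"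
    using s johnson_filtration_shift[OF t ma(1) mx(1)] johnson_filtration_shift[OF t mb(1) mx(1)]
    by (simp add: johnson_part_eq[OF s t A ax(1) X ax(3)] johnson_part_eq[OF s t B ax(2) X ax(3)]
        \<Gamma>.mult_gr_part)
  also have "\<dots> = johnson_part G s t A X \<otimes>\<^bsub>gr_part G (lower_central G) (s + t)\<^esub> johnson_part G s t B X"
    using johnson_part_closed[OF s t A X] johnson_part_closed[OF s t B X] by (rule P.m_comm[symmetric])
  finally show ?thesis .
qed

lemma johnson_part_one_left:
  assumes "s \<ge> 1" "t \<ge> 1" "X \<in> carrier (gr_part G (lower_central G) t)"
  shows "johnson_part G s t (johnson_filtration G (Suc s)) X = lower_central G (Suc (s + t))"
proof -
  obtain x where x: "x \<in> X" using \<Gamma>.gr_part_nonempty[OF assms(2,3)] .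
  have xc: "x \<in> carrier G" using \<Gamma>.gr_part_mem[OF assms(2,3) x] assms(2) \<Gamma>.K_carrier by blast
  have "\<one>\<^bsub>AutoGroup G\<^esub> \<in> johnson_filtration G (Suc s)"
    using subgroup_johnson_filtration by (rule subgroup.one_closed)
  then show ?thesis
    using johnson_part_eq[OF assms(1,2) F.K_in_carrier_gr_part[OF assms(1)] _ assms(3) x] xc
      subgroup.subset[OF subgroup_lower_central[of "Suc (s + t)"]]
    by (simp add: one_AutoGroup)
qed

lemma johnson_part_one_right:
  assumes "s \<ge> 1" "t \<ge> 1" "A \<in> carrier (gr_part (torelli G) (johnson_filtration G) s)"
  shows "johnson_part G s t A (lower_central G (Suc t)) = lower_central G (Suc (s + t))"
proof -
  obtain \<alpha> where \<alpha>: "\<alpha> \<in> A" using F.gr_part_nonempty[OF assms(1,3)] .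
  have "\<alpha> \<in> carrier (AutoGroup G)"
    using F.gr_part_mem[OF assms(1,3) \<alpha>] johnson_filtration_AutoGroup by blast
  then have "\<alpha> \<one> = \<one>" using group_hom_AutoGroup group_hom.hom_one by blast
  moreover have "\<one> \<in> lower_central G (Suc t)"
    using subgroup_lower_central[of "Suc t"] by (simp add: subgroup.one_closed)
  ultimately show ?thesis
    using johnson_part_eq[OF assms(1-3) \<alpha> \<Gamma>.K_in_carrier_gr_part[OF assms(2)]]
      subgroup.subset[OF subgroup_lower_central[of "Suc (s + t)"]]
    by simp
qed

lemma johnson_hom_apply:
  assumes "A \<in> carrier (gr_johnson G)" "X \<in> carrier (gr_lcs G)" "n \<ge> 1"
  shows "johnson_hom G A X n = finprod (gr_part G (lower_central G) n)
      (\<lambda>s. johnson_part G s (n - s) (A s) (X (n - s))) {1..<n}"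
  using assms by (simp add: johnson_hom_def)

lemma johnson_hom_summand_closed:
  assumes "A \<in> carrier (gr_johnson G)" "X \<in> carrier (gr_lcs G)"
  shows "(\<lambda>s. johnson_part G s (n - s) (A s) (X (n - s))) \<in> {1..<n} \<rightarrow> carrier (gr_part G (lower_central G) n)"
proof
  fix s assume s: "s \<in> {1..<n}"
  then have "johnson_part G s (n - s) (A s) (X (n - s)) \<in> carrier (gr_part G (lower_central G) (s + (n - s)))"
    using assms by (intro johnson_part_closed F.gr_component \<Gamma>.gr_component) auto
  then show "johnson_part G s (n - s) (A s) (X (n - s)) \<in> carrier (gr_part G (lower_central G) n)"
    using s by simp
qed

lemma johnson_hom_mult:
  assumes A: "A \<in> carrier (gr_johnson G)" and B: "B \<in> carrier (gr_johnson G)"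
  shows "johnson_hom G (A \<otimes>\<^bsub>gr_johnson G\<^esub> B)
    = johnson_hom G A \<otimes>\<^bsub>Der (gr_lcs G)\<^esub> johnson_hom G B"
proof -
  interpret J: group "gr_johnson G" by (rule F.group_gr)
  have AB: "A \<otimes>\<^bsub>gr_johnson G\<^esub> B \<in> carrier (gr_johnson G)" using A B by simp
  have "johnson_hom G (A \<otimes>\<^bsub>gr_johnson G\<^esub> B) X = johnson_hom G A X \<otimes>\<^bsub>gr_lcs G\<^esub> johnson_hom G B X"
    if X: "X \<in> carrier (gr_lcs G)" for X
  proof
    fix n
    show "johnson_hom G (A \<otimes>\<^bsub>gr_johnson G\<^esub> B) X n = (johnson_hom G A X \<otimes>\<^bsub>gr_lcs G\<^esub> johnson_hom G B X) n"
    proof (cases "n \<ge> 1")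
      case True
      interpret P: comm_group "gr_part G (lower_central G) n" by (rule \<Gamma>.comm_group_gr_part[OF True])
      have eq: "johnson_part G s (n - s) ((A \<otimes>\<^bsub>gr_johnson G\<^esub> B) s) (X (n - s))
          = johnson_part G s (n - s) (A s) (X (n - s)) \<otimes>\<^bsub>gr_part G (lower_central G) n\<^esub>
            johnson_part G s (n - s) (B s) (X (n - s))" if "s \<in> {1..<n}" for s
      proof -
        have s: "s \<ge> 1" "n - s \<ge> 1" "s + (n - s) = n" using that by auto
        show ?thesis
          using johnson_part_mult[of s "n - s" "A s" "B s" "X (n - s)"] s
            F.gr_component[OF A, of s] F.gr_component[OF B, of s] \<Gamma>.gr_component[OF X, of "n - s"]
          by (simp add: F.mult_gr_apply)
      qed
      note cl = johnson_hom_summand_closed[OF A X, of n] johnson_hom_summand_closed[OF B X, of n]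
      have "johnson_hom G (A \<otimes>\<^bsub>gr_johnson G\<^esub> B) X n
        = finprod (gr_part G (lower_central G) n)
          (\<lambda>s. johnson_part G s (n - s) (A s) (X (n - s)) \<otimes>\<^bsub>gr_part G (lower_central G) n\<^esub>
            johnson_part G s (n - s) (B s) (X (n - s))) {1..<n}"
        unfolding johnson_hom_apply[OF AB X True]
        by (rule P.finprod_cong'[OF refl _ eq]) (use cl in \<open>auto simp: Pi_iff\<close>)
      then show ?thesis
        using cl True by (simp add: johnson_hom_apply[OF _ X] A B P.finprod_multf \<Gamma>.mult_gr_apply)
    next
      \<comment> \<open>In degree 0 both families are \<open>undefined\<close>, being extensional
        over the degrees from 1 on.\<close>
      case False
      then show ?thesis using X AB by (simp add: johnson_hom_def) (simp add: gr_def)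
    qed
  qed
  then show ?thesis
    using A B AB
    by (auto simp: Der_def derivation_group_def fun_eq_iff restrict_def) (auto simp: johnson_hom_def)
qed

text \<open>In total degree s + 1 a class of degree one meets only the component A s, so every other
  summand is trivial. Degree one matters because \<Gamma>^1 is all of G, the set on which F^s tests
  automorphisms.\<close>

lemma johnson_hom_single:
  assumes A: "A \<in> carrier (gr_johnson G)" and s: "s \<ge> 1" and \<alpha>: "\<alpha> \<in> A s" and x: "x \<in> carrier G"
  shows "johnson_hom G A (\<Gamma>.gr_single 1 x) (Suc s) = lower_central G (Suc (Suc s)) #> (\<alpha> x \<otimes> inv x)"
proof -
  let ?X = "\<Gamma>.gr_single 1 x" and ?P = "gr_part G (lower_central G) (Suc s)"
  interpret P: comm_group ?P by (rule \<Gamma>.comm_group_gr_part) simp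
  have X: "?X \<in> carrier (gr_lcs G)" using x by (intro \<Gamma>.gr_single_closed) auto
  let ?f = "\<lambda>i. johnson_part G i (Suc s - i) (A i) (?X (Suc s - i))"
  note cl = johnson_hom_summand_closed[OF A X, of "Suc s"]
  have one: "?f i = \<one>\<^bsub>?P\<^esub>" if i: "i \<in> {1..<Suc s}" "i \<noteq> s" for i
  proof -
    have "?X (Suc s - i) = lower_central G (Suc (Suc s - i))"
      using i by (intro \<Gamma>.gr_single_other) auto
    moreover have "johnson_part G i (Suc s - i) (A i) (lower_central G (Suc (Suc s - i)))
        = lower_central G (Suc (i + (Suc s - i)))"
      using i A by (intro johnson_part_one_right F.gr_component) auto
    ultimately show ?thesis using i by simp
  qed
  have "johnson_hom G A ?X (Suc s) = finprod ?P ?f {1..<Suc s}"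
    by (rule johnson_hom_apply[OF A X]) simp
  also have "\<dots> = finprod ?P (\<lambda>i. if i = s then ?f i else \<one>\<^bsub>?P\<^esub>) {1..<Suc s}"
    by (rule P.finprod_cong') (use cl one in \<open>auto simp: Pi_iff\<close>)
  also have "\<dots> = ?f s"
    by (rule P.finprod_singleton_swap) (use cl s in auto)
  also have "\<dots> = lower_central G (Suc (Suc s)) #> (\<alpha> x \<otimes> inv x)"
  proof -
    have "?X 1 = lower_central G (Suc 1) #> x" by (rule \<Gamma>.gr_single_same) simp
    then have "x \<in> ?X 1" using x rcos_self subgroup_lower_central[of "Suc 1"] by simp
    then show ?thesis
      using johnson_part_eq[of s 1 "A s" \<alpha> "?X 1" x] F.gr_component[OF A s] \<Gamma>.gr_component[OF X, of 1] s \<alpha>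
      by simp
  qed
  finally show ?thesis .
qed

text \<open>On classes of degree one, equal values say that \<alpha> and \<beta> displace every x
  equally modulo \<Gamma>^(s+2), so \<alpha> \<beta>^-1 lies in F^(s+1). The argument treats each
  component by itself and so covers non-homogeneous A and B, as the comparison of cosets of inner
  derivations requires.\<close>

lemma inj_on_johnson_hom: "inj_on (johnson_hom G) (carrier (gr_johnson G))"
proof (rule inj_onI)
  fix A B assume A: "A \<in> carrier (gr_johnson G)" and B: "B \<in> carrier (gr_johnson G)"
    and eq: "johnson_hom G A = johnson_hom G B"
  show "A = B"
  proof (rule F.gr_eqI[OF A B])
    fix s :: nat assume s: "s \<ge> 1"
    obtain \<alpha> \<beta> where ab: "\<alpha> \<in> A s" "\<beta> \<in> B s"
      using F.gr_component_nonempty[OF A s] F.gr_component_nonempty[OF B s] by metis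
    note ma = F.gr_component_mem[OF A s ab(1)] and mb = F.gr_component_mem[OF B s ab(2)]
    have c: "\<alpha> \<in> carrier (AutoGroup G)" "\<beta> \<in> carrier (AutoGroup G)"
      using ma mb johnson_filtration_AutoGroup by blast+
    have T: "\<alpha> \<in> carrier (torelli G)" "\<beta> \<in> carrier (torelli G)"
      using ma(1) mb(1) s F.K_carrier by blast+
    let ?\<gamma> = "\<alpha> \<otimes>\<^bsub>AutoGroup G\<^esub> inv\<^bsub>AutoGroup G\<^esub> \<beta>"
    have "?\<gamma> \<in> johnson_filtration G (Suc s)"
    proof (rule johnson_filtrationI)
      fix y assume y: "y \<in> carrier G"
      then obtain x where x: "x \<in> carrier G" "\<beta> x = y" using AutoGroup_surj[OF c(2)] by metis
      have xc: "\<alpha> x \<in> carrier G" "\<beta> x \<in> carrier G" using AutoGroup_closed c x(1) by metis+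
      have "lower_central G (Suc (Suc s)) #> (\<alpha> x \<otimes> inv x) = lower_central G (Suc (Suc s)) #> (\<beta> x \<otimes> inv x)"
        using johnson_hom_single[OF A s ab(1) x(1)] johnson_hom_single[OF B s ab(2) x(1)] eq by simp
      then have "(\<alpha> x \<otimes> inv x) \<otimes> inv (\<beta> x \<otimes> inv x) \<in> lower_central G (Suc (Suc s))"
        using xc x(1) \<Gamma>.K_coset_eq_iff[of "Suc (Suc s)" "\<alpha> x \<otimes> inv x" "\<beta> x \<otimes> inv x"] by simp
      then have "\<alpha> x \<otimes> inv y \<in> lower_central G (Suc (Suc s))"
        using xc x by (simp add: inv_mult_group m_assoc)
      moreover have "?\<gamma> y = (?\<gamma> \<otimes>\<^bsub>AutoGroup G\<^esub> \<beta>) x"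
        using mult_AutoGroup_apply[of ?\<gamma> G \<beta> x] c x y by simp
      then have "?\<gamma> y = \<alpha> x" using c by (simp add: A.m_assoc)
      ultimately show "?\<gamma> y \<otimes> inv y \<in> lower_central G (Suc (Suc s))" by simp
    qed (use c in simp)
    then show "A s = B s"
      using ma(2) mb(2) F.K_coset_eq_iff[of "Suc s" \<alpha> \<beta>] T inv_torelli[of \<beta>]
      by (simp add: carrier_torelli)
  qed
qed

section \<open>Classes of inner automorphisms and the adjoint action\<close>

lemma filtered_hom_inner_aut:
  "filtered_hom G (lower_central G) (torelli G) (johnson_filtration G) (inner_aut G)"
proof (intro filtered_hom.intro filtered_hom_axioms.intro)
  have "inner_aut G g \<in> johnson_filtration G 1" if "g \<in> carrier G" for g
    using that inner_aut_in_johnson_filtration[of 1 g] by simp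
  then show "group_hom G (torelli G) (inner_aut G)"
    by (simp add: group_hom_def group_hom_axioms_def hom_def is_group group_torelli
        carrier_torelli inner_aut_mult)
qed (simp_all add: \<Gamma>.filtered_group_axioms F.filtered_group_axioms inner_aut_in_johnson_filtration)

text \<open>The graded form of g \<mapsto> conjugation by g; followed by
  \<open>johnson_hom G\<close> it is the adjoint representation of \<open>gr_lcs G\<close>.\<close>

definition gr_inner :: "(nat \<Rightarrow> 'a set) \<Rightarrow> (nat \<Rightarrow> ('a \<Rightarrow> 'a) set)" where
  "gr_inner = gr_map G (lower_central G) (torelli G) (johnson_filtration G) (inner_aut G)"

interpretation I: filtered_hom G "lower_central G" "torelli G" "johnson_filtration G" "inner_aut G"
  by (rule filtered_hom_inner_aut)

lemma group_hom_gr_inner: "group_hom (gr_lcs G) (gr_johnson G) gr_inner"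
  unfolding gr_inner_def by (rule I.group_hom_gr_map)

text \<open>A representative x of X s yields the representative \<open>inner_aut G x\<close> on the
  right, whose displacement of y is the commutator of x and y.\<close>

lemma gr_part_bracket_eq_johnson_part:
  assumes X: "X \<in> carrier (gr_lcs G)" and Y: "Y \<in> carrier (gr_part G (lower_central G) t)"
    and s: "s \<ge> 1" and t: "t \<ge> 1"
  shows "gr_part_bracket G (lower_central G) s t (X s) Y = johnson_part G s t (gr_inner X s) Y"
proof -
  have "lower_central G (Suc (s + t)) #> group_commutator G x y = johnson_part G s t (gr_inner X s) Y"
    if x: "x \<in> X s" and y: "y \<in> Y" for x y
  proof -
    have mx: "x \<in> lower_central G s" using \<Gamma>.gr_component_mem[OF X s x] by blast
    have c: "x \<in> carrier G" "y \<in> carrier G"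
      using mx s t \<Gamma>.gr_part_mem[OF t Y y] \<Gamma>.K_carrier by blast+
    have gx: "gr_inner X s = johnson_filtration G (Suc s) #>\<^bsub>torelli G\<^esub> inner_aut G x"
      unfolding gr_inner_def by (rule I.gr_map_component[OF X s x])
    have "inner_aut G x \<in> gr_inner X s"
      unfolding gx using c(1) by (intro F.rcos_self I.hom_closed F.subgroup_K) auto
    moreover have "gr_inner X s \<in> carrier (gr_part (torelli G) (johnson_filtration G) s)"
      unfolding gr_inner_def by (rule F.gr_component[OF I.gr_map_closed[OF X] s])
    ultimately have "johnson_part G s t (gr_inner X s) Y
        = lower_central G (Suc (s + t)) #> (inner_aut G x y \<otimes> inv y)"
      using johnson_part_eq[OF s t _ _ Y y] by blast
    then show ?thesis using c by (simp add: inner_aut_displacement)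
  qed
  moreover obtain x y where "x \<in> X s" "y \<in> Y"
    using \<Gamma>.gr_component_nonempty[OF X s] \<Gamma>.gr_part_nonempty[OF t Y] by metis
  ultimately show ?thesis
    unfolding gr_part_bracket_def by (intro the_elem_image_const) auto
qed

lemma bracket_gr_lcs:
  assumes X: "X \<in> carrier (gr_lcs G)" and Y: "Y \<in> carrier (gr_lcs G)"
  shows "bracket (gr_lcs G) X Y = johnson_hom G (gr_inner X) Y"
proof
  fix n
  interpret h: group_hom "gr_lcs G" "gr_johnson G" gr_inner by (rule group_hom_gr_inner)
  note cl = johnson_hom_summand_closed[OF h.hom_closed[OF X] Y, of n]
  show "bracket (gr_lcs G) X Y n = johnson_hom G (gr_inner X) Y n"
  proof (cases "n \<ge> 1")
    case True
    interpret P: comm_group "gr_part G (lower_central G) n" by (rule \<Gamma>.comm_group_gr_part[OF True])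
    have eq: "gr_part_bracket G (lower_central G) s (n - s) (X s) (Y (n - s))
        = johnson_part G s (n - s) (gr_inner X s) (Y (n - s))" if "s \<in> {1..<n}" for s
      by (rule gr_part_bracket_eq_johnson_part[OF X \<Gamma>.gr_component[OF Y]]) (use that in auto)
    have "bracket (gr_lcs G) X Y n = finprod (gr_part G (lower_central G) n)
        (\<lambda>s. gr_part_bracket G (lower_central G) s (n - s) (X s) (Y (n - s))) {1..<n}"
      using True by (simp add: gr_def)
    also have "\<dots> = johnson_hom G (gr_inner X) Y n"
      unfolding johnson_hom_apply[OF h.hom_closed[OF X] Y True]
      by (rule P.finprod_cong'[OF refl cl eq])
    finally show ?thesis .
  next
    case False
    then show ?thesis using Y h.hom_closed[OF X] by (simp add: johnson_hom_def) (simp add: gr_def)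
  qed
qed

lemma johnson_hom_one:
  assumes X: "X \<in> carrier (gr_lcs G)"
  shows "johnson_hom G \<one>\<^bsub>gr_johnson G\<^esub> X = \<one>\<^bsub>gr_lcs G\<^esub>"
proof
  fix n
  have one: "\<one>\<^bsub>gr_johnson G\<^esub> \<in> carrier (gr_johnson G)"
    using monoid.one_closed[OF group.is_monoid[OF F.group_gr]] .
  show "johnson_hom G \<one>\<^bsub>gr_johnson G\<^esub> X n = \<one>\<^bsub>gr_lcs G\<^esub> n"
  proof (cases "n \<ge> 1")
    case True
    interpret P: comm_group "gr_part G (lower_central G) n" by (rule \<Gamma>.comm_group_gr_part[OF True])
    have "johnson_hom G \<one>\<^bsub>gr_johnson G\<^esub> X n = \<one>\<^bsub>gr_part G (lower_central G) n\<^esub>"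
      unfolding johnson_hom_apply[OF one X True]
    proof (rule P.finprod_one_eqI)
      fix s assume s: "s \<in> {1..<n}"
      then have "johnson_part G s (n - s) (johnson_filtration G (Suc s)) (X (n - s))
          = lower_central G (Suc (s + (n - s)))"
        using X by (intro johnson_part_one_left \<Gamma>.gr_component) auto
      then show "johnson_part G s (n - s) (\<one>\<^bsub>gr_johnson G\<^esub> s) (X (n - s)) = \<one>\<^bsub>gr_part G (lower_central G) n\<^esub>"
        using s by (simp add: F.one_gr)
    qed
    then show ?thesis using True by (simp add: \<Gamma>.one_gr)
  next
    case False
    then show ?thesis using X one by (simp add: johnson_hom_def \<Gamma>.one_gr)
  qed
qed

lemma inner_aut_in_johnson_filtration_iff:
  assumes Z: "lie_center (gr_lcs G) = {\<one>\<^bsub>gr_lcs G\<^esub>}" and g: "g \<in> carrier G" and "s \<ge> 1"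
  shows "inner_aut G g \<in> johnson_filtration G s \<longleftrightarrow> g \<in> lower_central G s"
proof
  assume "inner_aut G g \<in> johnson_filtration G s"
  with \<open>s \<ge> 1\<close> show "g \<in> lower_central G s"
  proof (induction s rule: dec_induct)
    case base
    then show ?case using g by simp
  next
    case (step s)
    then have gs: "g \<in> lower_central G s" using johnson_filtration_Suc_subset by blast
    let ?X = "\<Gamma>.gr_single s g"
    have X: "?X \<in> carrier (gr_lcs G)" by (rule \<Gamma>.gr_single_closed[OF step.hyps(1) gs])
    \<comment> \<open>Conjugation by g lies in F^(s+1), so its class in degree s vanishes, and with
      it every bracket of \<open>?X\<close>.\<close>
    have "gr_inner ?X = \<one>\<^bsub>gr_johnson G\<^esub>"
      unfolding gr_inner_def
      using step.prems I.h_K[OF step.hyps(1) gs]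
      by (simp add: I.gr_map_single[OF step.hyps(1) gs] F.gr_single_eq_one_iff[OF step.hyps(1)])
    then have "?X \<in> lie_center (gr_lcs G)"
      using X by (simp add: lie_center_def bracket_gr_lcs johnson_hom_one)
    then have "?X = \<one>\<^bsub>gr_lcs G\<^esub>" using Z by blast
    then show ?case using \<Gamma>.gr_single_eq_one_iff[OF step.hyps(1) gs] by blast
  qed
qed (rule inner_aut_in_johnson_filtration[OF \<open>s \<ge> 1\<close>])

end

section \<open>The outer Johnson homomorphism\<close>

context group begin

interpretation \<Gamma>: filtered_group G "lower_central G" by (rule filtered_group_lower_central)
interpretation F: filtered_group "torelli G" "johnson_filtration G" by (rule filtered_group_johnson)
interpretation O: filtered_group "outer_torelli G" "outer_johnson_filtration G"
  by (rule filtered_group_outer_johnson)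
interpretation I: filtered_hom G "lower_central G" "torelli G" "johnson_filtration G" "inner_aut G"
  by (rule filtered_hom_inner_aut)
interpretation gI: group_hom "gr_lcs G" "gr_johnson G" gr_inner by (rule group_hom_gr_inner)

lemma filtered_hom_out_proj:
  "filtered_hom (torelli G) (johnson_filtration G) (outer_torelli G) (outer_johnson_filtration G) (out_proj G)"
  by (intro filtered_hom.intro filtered_hom_axioms.intro)
    (auto simp: F.filtered_group_axioms O.filtered_group_axioms group_hom_out_proj outer_johnson_filtration_def)

interpretation P: filtered_hom "torelli G" "johnson_filtration G" "outer_torelli G"
    "outer_johnson_filtration G" "out_proj G"
  by (rule filtered_hom_out_proj)

lemma group_hom_gr_out_proj: "group_hom (gr_johnson G) (gr_outer_johnson G) (gr_out_proj G)"
  unfolding gr_out_proj_def by (rule P.group_hom_gr_map)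

lemma gr_out_proj_surj: "gr_out_proj G ` carrier (gr_johnson G) = carrier (gr_outer_johnson G)"
  unfolding gr_out_proj_def by (rule P.gr_map_surj) (simp add: outer_johnson_filtration_def)

interpretation gP: group_hom "gr_johnson G" "gr_outer_johnson G" "gr_out_proj G"
  by (rule group_hom_gr_out_proj)

lemma out_proj_eqD:
  assumes "\<alpha> \<in> carrier (AutoGroup G)" "\<beta> \<in> carrier (AutoGroup G)" "out_proj G \<alpha> = out_proj G \<beta>"
  obtains g where "g \<in> carrier G" "\<alpha> = inner_aut G g \<otimes>\<^bsub>AutoGroup G\<^esub> \<beta>"
proof -
  interpret A: group "AutoGroup G" by (rule AutoGroup)
  interpret N: normal "inner_automorphisms G" "AutoGroup G" by (rule normal_inner_automorphisms)
  have "\<alpha> \<in> inner_automorphisms G #>\<^bsub>AutoGroup G\<^esub> \<beta>"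
    using assms A.rcos_self[OF assms(1) N.subgroup_axioms] by (simp add: out_proj_def)
  then show thesis using that by (auto simp: r_coset_def inner_automorphisms_eq)
qed

lemma out_proj_inner_aut:
  assumes "g \<in> carrier G"
  shows "out_proj G (inner_aut G g) = \<one>\<^bsub>outer_torelli G\<^esub>"
proof -
  interpret A: group "AutoGroup G" by (rule AutoGroup)
  interpret N: normal "inner_automorphisms G" "AutoGroup G" by (rule normal_inner_automorphisms)
  have "out_proj G (inner_aut G g) = inner_automorphisms G"
    unfolding out_proj_def
    using assms by (intro A.coset_join2 N.subgroup_axioms inner_aut_in_AutoGroup)
      (auto simp: inner_automorphisms_eq)
  then show ?thesis by (simp add: outer_torelli_def OutGroup_def)
qed

text \<open>One half of exactness in the middle of the sequence formed by \<open>gr_inner\<close>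
  and \<open>gr_out_proj G\<close>; the other half is \<open>gr_out_proj_eqD\<close>.\<close>

lemma gr_out_proj_gr_inner:
  assumes X: "X \<in> carrier (gr_lcs G)"
  shows "gr_out_proj G (gr_inner X) = \<one>\<^bsub>gr_outer_johnson G\<^esub>"
proof (rule O.gr_eqI)
  show "gr_out_proj G (gr_inner X) \<in> carrier (gr_outer_johnson G)"
    using X by simp
  show "\<one>\<^bsub>gr_outer_johnson G\<^esub> \<in> carrier (gr_outer_johnson G)" by (rule gP.H.one_closed)
  fix s :: nat assume s: "s \<ge> 1"
  obtain x where x: "x \<in> X s" using \<Gamma>.gr_component_nonempty[OF X s] .
  have xc: "x \<in> carrier G" using \<Gamma>.gr_component_mem[OF X s x] s \<Gamma>.K_carrier by blast
  have "gr_inner X s = johnson_filtration G (Suc s) #>\<^bsub>torelli G\<^esub> inner_aut G x"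
    unfolding gr_inner_def by (rule I.gr_map_component[OF X s x])
  then have "inner_aut G x \<in> gr_inner X s"
    using F.rcos_self[OF I.hom_closed[OF xc] F.subgroup_K[of "Suc s"]] by simp
  then have "gr_out_proj G (gr_inner X) s
      = outer_johnson_filtration G (Suc s) #>\<^bsub>outer_torelli G\<^esub> out_proj G (inner_aut G x)"
    unfolding gr_out_proj_def by (rule P.gr_map_component[OF gI.hom_closed[OF X] s])
  then show "gr_out_proj G (gr_inner X) s = \<one>\<^bsub>gr_outer_johnson G\<^esub> s"
    using s O.subgroup_K[of "Suc s"] subgroup.subset[of "outer_johnson_filtration G (Suc s)" "outer_torelli G"]
    by (simp add: O.one_gr out_proj_inner_aut[OF xc])
qed

text \<open>The delicate half of exactness. In degree s, equal outer classes give \<alpha>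
  \<beta>^-1 = c \<phi> with c conjugation by some g and \<phi> in F^(s+1); only after g is known to
  lie in \<Gamma>^s(G) does it define a class of degree s, and this is where centerlessness
  enters.\<close>

lemma gr_out_proj_eqD:
  assumes Z: "lie_center (gr_lcs G) = {\<one>\<^bsub>gr_lcs G\<^esub>}"
    and A: "A \<in> carrier (gr_johnson G)" and B: "B \<in> carrier (gr_johnson G)"
    and eq: "gr_out_proj G A = gr_out_proj G B"
  obtains X where "X \<in> carrier (gr_lcs G)" "A = gr_inner X \<otimes>\<^bsub>gr_johnson G\<^esub> B"
proof -
  have "\<exists>g \<in> lower_central G s. A s =
      (johnson_filtration G (Suc s) #>\<^bsub>torelli G\<^esub> inner_aut G g) \<otimes>\<^bsub>gr_part (torelli G) (johnson_filtration G) s\<^esub> B s"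
    if s: "s \<ge> 1" for s
  proof -
    interpret Q: group "gr_part (torelli G) (johnson_filtration G) s" by (rule F.group_gr_part[OF s])
    interpret S: subgroup "johnson_filtration G s" "torelli G" by (rule F.subgroup_K[OF s])
    obtain \<alpha> \<beta> where ab: "\<alpha> \<in> A s" "\<beta> \<in> B s"
      using F.gr_component_nonempty[OF A s] F.gr_component_nonempty[OF B s] by metis
    note ma = F.gr_component_mem[OF A s ab(1)] and mb = F.gr_component_mem[OF B s ab(2)]
    let ?\<gamma> = "\<alpha> \<otimes>\<^bsub>torelli G\<^esub> inv\<^bsub>torelli G\<^esub> \<beta>"
    have \<gamma>: "?\<gamma> \<in> johnson_filtration G s" using ma mb by blast
    have T: "\<alpha> \<in> carrier (torelli G)" "\<beta> \<in> carrier (torelli G)" using S.subset ma(1) mb(1) by blast+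
    have "outer_johnson_filtration G (Suc s) #>\<^bsub>outer_torelli G\<^esub> out_proj G \<alpha>
        = outer_johnson_filtration G (Suc s) #>\<^bsub>outer_torelli G\<^esub> out_proj G \<beta>"
      using P.gr_map_component[OF A s ab(1)] P.gr_map_component[OF B s ab(2)] eq
      by (simp add: gr_out_proj_def)
    then have "out_proj G ?\<gamma> \<in> outer_johnson_filtration G (Suc s)"
      using O.K_coset_eq_iff[of "Suc s" "out_proj G \<alpha>" "out_proj G \<beta>"] T by (simp del: mult_torelli)
    then obtain \<phi> where \<phi>: "\<phi> \<in> johnson_filtration G (Suc s)" "out_proj G ?\<gamma> = out_proj G \<phi>"
      by (auto simp: outer_johnson_filtration_def)
    obtain g where g: "g \<in> carrier G" "?\<gamma> = inner_aut G g \<otimes>\<^bsub>AutoGroup G\<^esub> \<phi>"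
      using out_proj_eqD[OF _ _ \<phi>(2)] \<gamma> \<phi>(1) johnson_filtration_AutoGroup by metis
    have \<phi>s: "\<phi> \<in> johnson_filtration G s" using \<phi>(1) F.K_Suc_mem[OF s] by blast
    have \<phi>T: "\<phi> \<in> carrier (torelli G)" using S.subset \<phi>s by blast
    have gT: "inner_aut G g \<in> carrier (torelli G)" using g(1) by simp
    have g': "?\<gamma> = inner_aut G g \<otimes>\<^bsub>torelli G\<^esub> \<phi>" using g(2) by simp
    \<comment> \<open>Solved for the conjugation, the relation shows that it lies in F^s, because
      the other two factors do.\<close>
    then have "inner_aut G g = ?\<gamma> \<otimes>\<^bsub>torelli G\<^esub> inv\<^bsub>torelli G\<^esub> \<phi>"
      using gT \<phi>T by (simp add: F.m_assoc del: mult_torelli one_torelli)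
    then have gs: "inner_aut G g \<in> johnson_filtration G s"
      using \<gamma> \<phi>s by (metis S.m_closed S.m_inv_closed)
    then have "g \<in> lower_central G s"
      using inner_aut_in_johnson_filtration_iff[OF Z g(1) s] by blast
    moreover have "A s = (johnson_filtration G (Suc s) #>\<^bsub>torelli G\<^esub> inner_aut G g)
        \<otimes>\<^bsub>gr_part (torelli G) (johnson_filtration G) s\<^esub> B s"
    proof -
      let ?c = "\<lambda>\<xi>. johnson_filtration G (Suc s) #>\<^bsub>torelli G\<^esub> \<xi>"
      have cl: "?c \<xi> \<in> carrier (gr_part (torelli G) (johnson_filtration G) s)"
        if "\<xi> \<in> johnson_filtration G s" for \<xi>
        using that by (auto simp: F.carrier_gr_part)
      have "?c \<phi> = \<one>\<^bsub>gr_part (torelli G) (johnson_filtration G) s\<^esub>"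
        using F.K_coset_eq_K_iff[of "Suc s" \<phi>] \<phi>(1) \<phi>T by simp
      then have "?c ?\<gamma> = ?c (inner_aut G g)"
        using F.mult_gr_part[OF s gs \<phi>s] Q.r_one[OF cl[OF gs]] g' by (simp del: mult_torelli r_coset_torelli)
      moreover have "?c \<alpha> = ?c ?\<gamma> \<otimes>\<^bsub>gr_part (torelli G) (johnson_filtration G) s\<^esub> ?c \<beta>"
        using F.mult_gr_part[OF s \<gamma> mb(1)] T by (simp add: F.m_assoc del: mult_torelli one_torelli r_coset_torelli)
      ultimately show ?thesis using ma(2) mb(2) by simp
    qed
    ultimately show ?thesis by blast
  qed
  then obtain g where g: "g s \<in> lower_central G s"
      "A s = (johnson_filtration G (Suc s) #>\<^bsub>torelli G\<^esub> inner_aut G (g s))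
        \<otimes>\<^bsub>gr_part (torelli G) (johnson_filtration G) s\<^esub> B s" if "s \<ge> 1" for s
    by metis
  \<comment> \<open>Taking the unit wherever A and B agree confines the support of X to the union of
    their supports.\<close>
  define X where
    "X = (\<lambda>s \<in> {1..}. if A s = B s then lower_central G (Suc s) else lower_central G (Suc s) #> g s)"
  have X: "X \<in> carrier (gr_lcs G)"
  proof -
    have "X s \<in> carrier (gr_part G (lower_central G) s)" if "s \<ge> 1" for s
      using that g \<Gamma>.K_in_carrier_gr_part[OF that] by (simp add: X_def \<Gamma>.carrier_gr_part)
    moreover have "finite {s \<in> {1..}. X s \<noteq> lower_central G (Suc s)}"
      by (rule finite_subset[of _ "{s \<in> {1..}. A s \<noteq> johnson_filtration G (Suc s)} \<union>
            {s \<in> {1..}. B s \<noteq> johnson_filtration G (Suc s)}"])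
        (use A B in \<open>auto simp: X_def F.carrier_gr\<close>)
    moreover have "X \<in> extensional {1..}" by (simp add: X_def)
    ultimately show ?thesis by (auto simp: \<Gamma>.carrier_gr PiE_def)
  qed
  have gX: "gr_inner X \<in> carrier (gr_johnson G)" using X by simp
  have "A = gr_inner X \<otimes>\<^bsub>gr_johnson G\<^esub> B"
  proof (rule F.gr_eqI[OF A gI.H.m_closed[OF gX B]])
    fix s :: nat assume s: "s \<ge> 1"
    interpret Q: group "gr_part (torelli G) (johnson_filtration G) s" by (rule F.group_gr_part[OF s])
    show "A s = (gr_inner X \<otimes>\<^bsub>gr_johnson G\<^esub> B) s"
    proof (cases "A s = B s")
      case True
      then have "X s = lower_central G (Suc s)" using s by (simp add: X_def)
      then have "gr_inner X s = \<one>\<^bsub>gr_part (torelli G) (johnson_filtration G) s\<^esub>"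
        unfolding gr_inner_def using I.gr_map_trivial_component[OF X s] by simp
      then show ?thesis using True Q.l_one[OF F.gr_component[OF B s]] s by (simp add: F.mult_gr_apply)
    next
      case False
      then have "X s = lower_central G (Suc s) #> g s" using s by (simp add: X_def)
      then have "g s \<in> X s"
        using rcos_self[OF \<Gamma>.K_carrier[OF s g(1)[OF s]] subgroup_lower_central[of "Suc s"]] by simp
      then have "gr_inner X s = johnson_filtration G (Suc s) #>\<^bsub>torelli G\<^esub> inner_aut G (g s)"
        unfolding gr_inner_def by (rule I.gr_map_component[OF X s])
      then show ?thesis using g(2)[OF s] s by (simp add: F.mult_gr_apply)
    qed
  qed
  with X show thesis by (rule that)
qed

text \<open>Inner derivations are the values of J on classes of inner automorphisms, and J is
  multiplicative; so the coset is an explicit set of values of J and can be compared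
  elementwise.\<close>

lemma Der_proj_johnson_hom:
  assumes A: "A \<in> carrier (gr_johnson G)"
  shows "Der_proj (gr_lcs G) (johnson_hom G A)
    = (\<lambda>X. johnson_hom G (gr_inner X \<otimes>\<^bsub>gr_johnson G\<^esub> A)) ` carrier (gr_lcs G)"
proof -
  have "inner_derivations (gr_lcs G) = (\<lambda>X. johnson_hom G (gr_inner X)) ` carrier (gr_lcs G)"
    unfolding inner_derivations_def
  proof (rule image_cong[OF refl])
    fix X assume X: "X \<in> carrier (gr_lcs G)"
    have "johnson_hom G (gr_inner X) \<in> extensional (carrier (gr_lcs G))"
      using gI.hom_closed[OF X] by (simp add: johnson_hom_def)
    then show "(\<lambda>Y \<in> carrier (gr_lcs G). bracket (gr_lcs G) X Y) = johnson_hom G (gr_inner X)"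
      by (intro extensionalityI[of _ "carrier (gr_lcs G)"]) (auto simp: bracket_gr_lcs[OF X])
  qed
  then show ?thesis
    using A by (auto simp: Der_proj_def r_coset_def johnson_hom_mult)
qed

text \<open>From left to right, J(A) is a member of the other coset, and injectivity of J takes this
  relation back to \<open>gr_johnson G\<close>. From right to left, the factor supplied by
  \<open>gr_out_proj_eqD\<close> is absorbed by the coset. The second direction makes the outer
  Johnson homomorphism well-defined, the first makes it injective.\<close>

lemma Der_proj_johnson_hom_eq_iff:
  assumes Z: "lie_center (gr_lcs G) = {\<one>\<^bsub>gr_lcs G\<^esub>}"
    and A: "A \<in> carrier (gr_johnson G)" and B: "B \<in> carrier (gr_johnson G)"
  shows "Der_proj (gr_lcs G) (johnson_hom G A) = Der_proj (gr_lcs G) (johnson_hom G B)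
    \<longleftrightarrow> gr_out_proj G A = gr_out_proj G B"
proof
  assume eq: "Der_proj (gr_lcs G) (johnson_hom G A) = Der_proj (gr_lcs G) (johnson_hom G B)"
  have "johnson_hom G A = johnson_hom G (gr_inner \<one>\<^bsub>gr_lcs G\<^esub> \<otimes>\<^bsub>gr_johnson G\<^esub> A)"
    using A by simp
  then have "johnson_hom G A \<in> Der_proj (gr_lcs G) (johnson_hom G B)"
    unfolding eq[symmetric] Der_proj_johnson_hom[OF A]
    using gI.G.one_closed by (rule image_eqI)
  then obtain X where X: "X \<in> carrier (gr_lcs G)"
    "johnson_hom G A = johnson_hom G (gr_inner X \<otimes>\<^bsub>gr_johnson G\<^esub> B)"
    unfolding Der_proj_johnson_hom[OF B] by blast
  then have "A = gr_inner X \<otimes>\<^bsub>gr_johnson G\<^esub> B"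
    using A B by (intro inj_onD[OF inj_on_johnson_hom]) simp_all
  then show "gr_out_proj G A = gr_out_proj G B"
    using X(1) B by (simp add: gr_out_proj_gr_inner)
next
  have sub: "Der_proj (gr_lcs G) (johnson_hom G A) \<subseteq> Der_proj (gr_lcs G) (johnson_hom G B)"
    if A: "A \<in> carrier (gr_johnson G)" and B: "B \<in> carrier (gr_johnson G)"
      and eq: "gr_out_proj G A = gr_out_proj G B" for A B
  proof -
    obtain X where X: "X \<in> carrier (gr_lcs G)" "A = gr_inner X \<otimes>\<^bsub>gr_johnson G\<^esub> B"
      using gr_out_proj_eqD[OF Z A B eq] .
    show ?thesis
      unfolding Der_proj_johnson_hom[OF A] Der_proj_johnson_hom[OF B]
    proof (rule image_subsetI)
      fix Y assume Y: "Y \<in> carrier (gr_lcs G)"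
      have "gr_inner Y \<otimes>\<^bsub>gr_johnson G\<^esub> A = gr_inner (Y \<otimes>\<^bsub>gr_lcs G\<^esub> X) \<otimes>\<^bsub>gr_johnson G\<^esub> B"
        using X Y B by (simp add: gI.H.m_assoc)
      then show "johnson_hom G (gr_inner Y \<otimes>\<^bsub>gr_johnson G\<^esub> A)
          \<in> (\<lambda>X. johnson_hom G (gr_inner X \<otimes>\<^bsub>gr_johnson G\<^esub> B)) ` carrier (gr_lcs G)"
        by (intro image_eqI[OF _ gI.G.m_closed[OF Y X(1)]] arg_cong[where f = "johnson_hom G"])
    qed
  qed
  assume "gr_out_proj G A = gr_out_proj G B"
  then show "Der_proj (gr_lcs G) (johnson_hom G A) = Der_proj (gr_lcs G) (johnson_hom G B)"
    using sub[OF A B] sub[OF B A] by auto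
qed

text \<open>The description by \<open>THE\<close> denotes a solution once there is exactly one.
  Evaluating at any chosen preimage gives a solution, since the coset does not depend on the choice;
  surjectivity of \<open>gr_out_proj G\<close> and extensionality make it unique.\<close>

lemma outer_johnson_hom_gr_out_proj:
  assumes Z: "lie_center (gr_lcs G) = {\<one>\<^bsub>gr_lcs G\<^esub>}" and "A \<in> carrier (gr_johnson G)"
  shows "outer_johnson_hom G (gr_out_proj G A) = Der_proj (gr_lcs G) (johnson_hom G A)"
proof -
  let ?Q = "\<lambda>f. f \<in> extensional (carrier (gr_outer_johnson G)) \<and>
    (\<forall>A \<in> carrier (gr_johnson G). f (gr_out_proj G A) = Der_proj (gr_lcs G) (johnson_hom G A))"
  define f where "f = (\<lambda>U \<in> carrier (gr_outer_johnson G). Der_proj (gr_lcs G)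
    (johnson_hom G (inv_into (carrier (gr_johnson G)) (gr_out_proj G) U)))"
  have "f (gr_out_proj G A) = Der_proj (gr_lcs G) (johnson_hom G A)"
    if A: "A \<in> carrier (gr_johnson G)" for A
  proof -
    let ?B = "inv_into (carrier (gr_johnson G)) (gr_out_proj G) (gr_out_proj G A)"
    have "?B \<in> carrier (gr_johnson G)" "gr_out_proj G ?B = gr_out_proj G A"
      using A by (simp_all add: inv_into_into f_inv_into_f)
    then show ?thesis
      using A Der_proj_johnson_hom_eq_iff[OF Z, of ?B A] by (simp add: f_def)
  qed
  then have "?Q f" by (simp add: f_def)
  moreover have "g = f" if g: "?Q g" for g
  proof (rule extensionalityI[of _ "carrier (gr_outer_johnson G)"])
    fix U assume "U \<in> carrier (gr_outer_johnson G)"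
    then obtain A where "A \<in> carrier (gr_johnson G)" "U = gr_out_proj G A"
      using gr_out_proj_surj by blast
    then show "g U = f U" using g \<open>?Q f\<close> by simp
  qed (use g \<open>?Q f\<close> in blast)+
  ultimately have "?Q (outer_johnson_hom G)"
    unfolding outer_johnson_hom_def by (rule theI)
  then show ?thesis using assms(2) by blast
qed

lemma inj_on_outer_johnson_hom:
  assumes Z: "lie_center (gr_lcs G) = {\<one>\<^bsub>gr_lcs G\<^esub>}"
  shows "inj_on (outer_johnson_hom G) (carrier (gr_outer_johnson G))"
proof (rule inj_onI)
  fix U V assume "U \<in> carrier (gr_outer_johnson G)" "V \<in> carrier (gr_outer_johnson G)"
    and eq: "outer_johnson_hom G U = outer_johnson_hom G V"
  then obtain A B where "A \<in> carrier (gr_johnson G)" "U = gr_out_proj G A"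
    "B \<in> carrier (gr_johnson G)" "V = gr_out_proj G B"
    using gr_out_proj_surj by blast
  then show "U = V"
    using eq by (simp add: outer_johnson_hom_gr_out_proj[OF Z] Der_proj_johnson_hom_eq_iff[OF Z])
qed

section \<open>Injectivity and equality of filtrations\<close>

lemma johnson_injective_iff:
  "(\<forall>s \<in> {1..q}. inj_on (johnson_hom G \<circ> iota G) (homog (gr_lcs (torelli G)) s))
    \<longleftrightarrow> (\<forall>s \<in> {1..q + 1}. lower_central (torelli G) s = johnson_filtration G s)"
proof -
  interpret i: filtered_hom "torelli G" "lower_central (torelli G)" "torelli G" "johnson_filtration G" id
    by (rule F.filtered_hom_lower_central)
  have "inj_on (johnson_hom G) (homog (gr_johnson G) s)" for s
    by (rule inj_on_subset[OF inj_on_johnson_hom]) (auto simp: F.homog_gr)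
  then show ?thesis
    unfolding iota_def F.lower_central_eq_iff[symmetric]
    by (intro ball_cong[OF refl]) (simp add: i.gr_map_inj_on_homog_iff)
qed

lemma outer_johnson_injective_iff:
  assumes "lie_center (gr_lcs G) = {\<one>\<^bsub>gr_lcs G\<^esub>}"
  shows "(\<forall>s \<in> {1..q}. inj_on (outer_johnson_hom G \<circ> outer_iota G) (homog (gr_lcs (outer_torelli G)) s))
    \<longleftrightarrow> (\<forall>s \<in> {1..q + 1}. lower_central (outer_torelli G) s = outer_johnson_filtration G s)"
proof -
  interpret i: filtered_hom "outer_torelli G" "lower_central (outer_torelli G)" "outer_torelli G"
      "outer_johnson_filtration G" id
    by (rule O.filtered_hom_lower_central)
  have "inj_on (outer_johnson_hom G) (homog (gr_outer_johnson G) s)" for s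
    by (rule inj_on_subset[OF inj_on_outer_johnson_hom[OF assms]]) (auto simp: O.homog_gr)
  then show ?thesis
    unfolding outer_iota_def O.lower_central_eq_iff[symmetric]
    by (intro ball_cong[OF refl]) (simp add: i.gr_map_inj_on_homog_iff)
qed

text \<open>For the step back to T, an element \<alpha> of F^s has the same outer class as some
  \<gamma> in \<Gamma>^s(T), so \<alpha> is a conjugation times \<gamma>. That conjugation then lies
  in F^s, hence comes from \<Gamma>^s(G), and the homomorphism from G to T sends \<Gamma>^s(G) into
  \<Gamma>^s(T).\<close>

lemma lower_central_torelli_eq_iff:
  assumes Z: "lie_center (gr_lcs G) = {\<one>\<^bsub>gr_lcs G\<^esub>}" and s: "s \<ge> 1"
  shows "lower_central (torelli G) s = johnson_filtration G s
    \<longleftrightarrow> lower_central (outer_torelli G) s = outer_johnson_filtration G s"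
proof
  assume "lower_central (torelli G) s = johnson_filtration G s"
  then show "lower_central (outer_torelli G) s = outer_johnson_filtration G s"
    by (simp add: lower_central_outer_torelli[OF s] outer_johnson_filtration_def)
next
  assume eq: "lower_central (outer_torelli G) s = outer_johnson_filtration G s"
  interpret L: subgroup "lower_central (torelli G) s" "torelli G" by (rule F.subgroup_lower_central[OF s])
  interpret S: subgroup "johnson_filtration G s" "torelli G" by (rule F.subgroup_K[OF s])
  have "\<alpha> \<in> lower_central (torelli G) s" if \<alpha>: "\<alpha> \<in> johnson_filtration G s" for \<alpha>
  proof -
    have "out_proj G \<alpha> \<in> out_proj G ` lower_central (torelli G) s"
      using eq \<alpha> by (simp add: lower_central_outer_torelli[OF s] outer_johnson_filtration_def)
    then obtain \<gamma> where \<gamma>: "\<gamma> \<in> lower_central (torelli G) s" "out_proj G \<alpha> = out_proj G \<gamma>" by blast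
    have \<gamma>s: "\<gamma> \<in> johnson_filtration G s" using \<gamma>(1) F.lower_central_subset_K[OF s] by blast
    obtain g where g: "g \<in> carrier G" "\<alpha> = inner_aut G g \<otimes>\<^bsub>AutoGroup G\<^esub> \<gamma>"
      using out_proj_eqD[OF _ _ \<gamma>(2)] \<alpha> \<gamma>s johnson_filtration_AutoGroup by metis
    have g': "\<alpha> = inner_aut G g \<otimes>\<^bsub>torelli G\<^esub> \<gamma>" using g(2) by simp
    have "\<gamma> \<in> carrier (torelli G)" "inner_aut G g \<in> carrier (torelli G)" using \<gamma>s g(1) by auto
    then have "inner_aut G g = \<alpha> \<otimes>\<^bsub>torelli G\<^esub> inv\<^bsub>torelli G\<^esub> \<gamma>"
      using g' by (simp add: F.m_assoc del: mult_torelli one_torelli)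
    then have "inner_aut G g \<in> johnson_filtration G s"
      using \<alpha> \<gamma>s by (metis S.m_closed S.m_inv_closed)
    then have "inner_aut G g \<in> lower_central (torelli G) s"
      using inner_aut_in_johnson_filtration_iff[OF Z g(1) s] I.lower_central_img_subset[of s] s by blast
    then show ?thesis using g' \<gamma>(1) by (metis L.m_closed)
  qed
  then show "lower_central (torelli G) s = johnson_filtration G s"
    using F.lower_central_subset_K[OF s] by blast
qed

end

theorem theorem4p5:
  fixes G :: "('a, 'b) monoid_scheme" and q :: nat
  assumes "group G"
    and "lie_center (gr_lcs G) = {\<one>\<^bsub>gr_lcs G\<^esub>}"
    and "q \<ge> 1"
  shows "let
      P1 = (\<forall>s \<in> {1..q}. inj_on (johnson_hom G \<circ> iota G)
        (homog (gr_lcs (torelli G)) s));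
      P2 = (\<forall>s \<in> {1..q}. inj_on (outer_johnson_hom G \<circ> outer_iota G)
        (homog (gr_lcs (outer_torelli G)) s));
      P3 = (\<forall>s \<in> {1..q + 1}. lower_central (torelli G) s = johnson_filtration G s);
      P4 = (\<forall>s \<in> {1..q + 1}.
        lower_central (outer_torelli G) s = outer_johnson_filtration G s)
    in (P1 \<longleftrightarrow> P2) \<and> (P2 \<longleftrightarrow> P3) \<and> (P3 \<longleftrightarrow> P4)"
proof -
  interpret group G by fact
  \<comment> \<open>Equality for T and for its outer quotient are equivalent in each degree
    separately, so the range of s is carried along unchanged.\<close>
  have "(\<forall>s \<in> {1..q + 1}. lower_central (torelli G) s = johnson_filtration G s)
    \<longleftrightarrow> (\<forall>s \<in> {1..q + 1}. lower_central (outer_torelli G) s = outer_johnson_filtration G s)"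
    by (intro ball_cong[OF refl] lower_central_torelli_eq_iff[OF assms(2)]) simp
  then show ?thesis
    unfolding Let_def johnson_injective_iff outer_johnson_injective_iff[OF assms(2)] by blast
qed

end
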